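(* Let $X$ be a non-negative absolutely continuous random variable with distribution function $F$, bounded probability density function $f$ and finite variance, and let $X_1,\ldots,X_n$ be a random sample (i.i.d.) from $F$. Let $m=m(n)$ be a positive integer smaller than $n/2$. Then $$VJQ_{m,n}\to VJ(X)\quad\text{in probability, as } n\to\infty,\ m\to\infty,\ \frac mn\to0.$$
   Context: The varextropy of a non-negative absolutely continuous random variable $X$ with density $f$ is $$VJ(X)=\mathrm{Var}\left[-\tfrac12 f(X)\right]=\tfrac14 E[f^2(X)]-J^2(X)=\tfrac14\left[\int_0^{\infty}f^3(x)\,dx-\left(\int_0^\infty f^2(x)\,dx\right)^2\right],\qquad J(X)=-\tfrac12\int_0^\infty f^2(x)\,dx .$$ Let $X_{(1)}\le\cdots\le X_{(n)}$ be the order statistics of the sample, with the convention $X_{(i)}=X_{(1)}$ if $i<1$ and $X_{(i)}=X_{(n)}$ if $i>n$. Put $$c_i=\begin{cases}1+\frac{i-1}{m},&1\le i\le m,\\ 2,&m+1\le i\le n-m,\\ 1+\frac{n-i}{m},&n-m+1\le i\le n.\end{cases}$$ The estimator is $$VJQ_{m,n}=\tfrac14\left[\frac1n\sum_{i=1}^n\left(\frac{c_i\frac mn}{X_{(i+m)}-X_{(i-m)}}\right)^2-\left(\frac1n\sum_{i=1}^n\frac{c_i\frac mn}{X_{(i+m)}-X_{(i-m)}}\right)^2\right].$$ *)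

theory Defs
  imports "HOL-Probability.Probability"
begin

text \<open>
  The varextropy $VJ(X) = \mathrm{Var}[-f(X)/2]$ of a random variable \<open>X\<close> on the probability
  space \<open>M\<close> with density \<open>f\<close>.  The value does not depend on the choice of the version of the density.
\<close>

definition varextropy :: "'a measure \<Rightarrow> ('a \<Rightarrow> real) \<Rightarrow> (real \<Rightarrow> real) \<Rightarrow> real" where
  "varextropy M X f = prob_space.variance M (\<lambda>\<omega>. - (1 / 2) * f (X \<omega>))"

text \<open>
  Order statistics $X_{(i)}$ of the sample \<open>x 1, \<dots>, x n\<close>, for an arbitrary integer index, with
  the convention $X_{(i)} = X_{(1)}$ for $i < 1$ and $X_{(i)} = X_{(n)}$ for $i > n$.
  Samples are indexed from 1, lists from 0.
\<close>

definition order_stat :: "nat \<Rightarrow> (nat \<Rightarrow> real) \<Rightarrow> int \<Rightarrow> real" where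
  "order_stat n x i =
     (let xs = sort (map x [1..<Suc n]) in
        if i < 1 then xs ! 0
        else if i > int n then xs ! (n - 1)
        else xs ! nat (i - 1))"

definition coef :: "nat \<Rightarrow> nat \<Rightarrow> nat \<Rightarrow> real" where
  "coef m n i =
     (if i \<le> m then 1 + (real i - 1) / real m
      else if i \<le> n - m then 2
      else 1 + (real n - real i) / real m)"

text \<open>
  A vanishing spacing makes the summand 0, as division by 0 yields 0; for samples from a continuous
  distribution this only happens on a null set.
\<close>

definition spacing_density :: "nat \<Rightarrow> nat \<Rightarrow> (nat \<Rightarrow> real) \<Rightarrow> nat \<Rightarrow> real" where
  "spacing_density m n x i =
     (coef m n i * (real m / real n))
       / (order_stat n x (int i + int m) - order_stat n x (int i - int m))"

definition VJQ :: "nat \<Rightarrow> nat \<Rightarrow> (nat \<Rightarrow> real) \<Rightarrow> real" where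
  "VJQ m n x =
     1 / 4 * (1 / real n * (\<Sum>i = 1..n. (spacing_density m n x i)\<^sup>2)
              - (1 / real n * (\<Sum>i = 1..n. spacing_density m n x i))\<^sup>2)"

definition tendsto_in_prob :: "'a measure \<Rightarrow> (nat \<Rightarrow> 'a \<Rightarrow> real) \<Rightarrow> real \<Rightarrow> bool" where
  "tendsto_in_prob N Y c \<longleftrightarrow>
     (\<forall>\<epsilon>>0. (\<lambda>n. measure N {\<omega> \<in> space N. \<bar>Y n \<omega> - c\<bar> > \<epsilon>}) \<longlonglongrightarrow> 0)"

end

theory Submission
  imports Defs "HOL-Probability.Hoeffding"
begin

text \<open>
  Write \<open>\<mu>\<close> for the law with density \<open>f \<le> B\<close>, let \<open>g i\<close> be the \<open>i\<close>-th spacing density, and let \<open>\<sigma>\<close>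
  be a permutation with \<open>X(i) = x (\<sigma> i)\<close>.  Up to the factor 1/4, the estimator is the empirical variance
  of the \<open>g i\<close>, and the varextropy is the variance of \<open>f\<close> under \<open>\<mu>\<close>.  So it suffices to show, for
  \<open>p = 1, 2\<close>, that the average of \<open>g i ^ p\<close> is close in probability to the average of \<open>f (x j) ^ p\<close>,
  and to apply the law of large numbers (here Hoeffding's inequality) to the bounded variables
  \<open>f (x j) ^ p\<close>.

  The comparison is made sample point by sample point, and order statistics are avoided altogether: how
  \<open>g i\<close> compares with a given level is read off from the number of other sample points in a window around
  \<open>x (\<sigma> i)\<close>.  Given the centre, such a number is a sum of i.i.d. indicators, so that it obeys the
  exponential bound \<open>near_count_chernoff\<close>.  Three facts control the error.

  \<^item> If \<open>g i > t\<close>, then the centre has at least \<open>m\<close> neighbours within distance \<open>2m/(nt)\<close>, a window of mass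
  at most \<open>4Bm/(nt)\<close>.  The probability is at most \<open>(4eB/t) ^ m\<close> (\<open>crowded_prob\<close>).  Summing over the levels
  \<open>t = 2 ^ k * T\<close> with \<open>T \<ge> 8eB\<close> shows that the spacing densities above \<open>T\<close> contribute \<open>O(2 ^ -m)\<close> to the
  expected mean square.  Since the estimator averages over the sample, such bounds for single points
  can be summed in expectation; uniform control over all points is never sought.

  \<^item> Let \<open>i\<close> have \<open>m\<close> indices on either side, and let the centre have fewer than \<open>m\<close> neighbours at the
  scale of the first fact for \<open>t = T\<close>.  Then \<open>\<bar>g i - f (x (\<sigma> i))\<bar> > 2\<epsilon>\<close> forces a one-sided window, whose
  length is \<open>m/n\<close> divided by \<open>f + \<epsilon>\<close> or \<open>f - \<epsilon>\<close>, to contain a number of points that differs from its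
  mean by a constant factor (\<open>spacing_density_close\<close>).  This is exponentially unlikely in \<open>m\<close>, provided
  that the mass of the window is nearly \<open>f\<close> at the centre times its length.

  \<^item> That proviso holds outside a set of small \<open>\<mu>\<close>-measure once \<open>m/n\<close> is small, since the mean
  oscillation of \<open>f\<close> over short intervals tends to 0 in \<open>\<mu>\<close>-mean (\<open>lebesgue_points_in_mean\<close>).  This
  average form replaces the pointwise Lebesgue differentiation theorem.

  The remaining \<open>2m\<close> boundary indices have vanishing proportion.  All error terms are bounded by measurable
  functions of neighbour counts (\<open>total_error\<close>), and Markov's inequality finishes the proof.
\<close>

section \<open>Local oscillation of a bounded density\<close>

text \<open>
  A measurable function is an almost everywhere limit of continuous ones; truncating these to \<open>[0, B]\<close>
  makes dominated convergence applicable on a bounded interval.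
\<close>

lemma continuous_approx_L1:
  fixes f :: "real \<Rightarrow> real"
  assumes [measurable]: "f \<in> borel_measurable borel"
    and f0: "\<And>x. 0 \<le> f x" and fB: "\<And>x. f x \<le> B" and "0 < \<eta>"
  shows "\<exists>g. continuous_on UNIV g \<and>
           (\<integral>\<^sup>+x. ennreal \<bar>f x - g x\<bar> * indicator {-K..K} x \<partial>lborel) \<le> ennreal \<eta>"
proof -
  have "f measurable_on UNIV"
    by (rule lebesgue_measurable_imp_measurable_on_real)
       (use measurable_completion[of f lborel borel] in auto)
  then obtain Z g where Z: "negligible Z" and g: "\<And>n. continuous_on UNIV (g n)"
    and lim: "\<And>x. x \<notin> Z \<Longrightarrow> (\<lambda>n. g n x) \<longlonglongrightarrow> f x"
    unfolding measurable_on_def by auto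
  define h where "h = (\<lambda>n x. max 0 (min B (g n x)))"
  have h_cont: "continuous_on UNIV (h n)" for n
    unfolding h_def by (intro continuous_intros g)
  have [measurable]: "h n \<in> borel_measurable borel" for n
    by (rule borel_measurable_continuous_onI[OF h_cont])
  have h_lim: "(\<lambda>n. h n x) \<longlonglongrightarrow> f x" if "x \<notin> Z" for x
  proof -
    have "(\<lambda>n. h n x) \<longlonglongrightarrow> max 0 (min B (f x))"
      unfolding h_def by (intro tendsto_intros lim that)
    then show ?thesis using f0[of x] fB[of x] by simp
  qed
  have "AE x in lebesgue. x \<notin> Z"
    using Z by (simp add: negligible_iff_null_sets AE_not_in)
  then have "AE x in lebesgue. (\<lambda>n. ennreal \<bar>f x - h n x\<bar> * indicator {-K..K} x) \<longlonglongrightarrow> 0"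
  proof (rule AE_mp, intro AE_I2 impI)
    fix x assume "x \<notin> Z"
    then have "(\<lambda>n. \<bar>f x - h n x\<bar>) \<longlonglongrightarrow> \<bar>f x - f x\<bar>"
      by (intro tendsto_intros h_lim)
    then have "(\<lambda>n. ennreal \<bar>f x - h n x\<bar>) \<longlonglongrightarrow> ennreal 0"
      by (intro tendsto_ennrealI) simp
    then show "(\<lambda>n. ennreal \<bar>f x - h n x\<bar> * indicator {-K..K} x) \<longlonglongrightarrow> 0"
      by (cases "x \<in> {-K..K}") (auto simp: indicator_def)
  qed
  then have ae: "AE x in lborel. (\<lambda>n. ennreal \<bar>f x - h n x\<bar> * indicator {-K..K} x) \<longlonglongrightarrow> 0"
    by (subst (asm) AE_completion_iff)
  have h0: "0 \<le> h n x" for n x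
    by (simp add: h_def)
  have hB: "h n x \<le> B" for n x
    using f0[of 0] fB[of 0] by (auto simp: h_def)
  have B0: "0 \<le> B" using f0[of 0] fB[of 0] by linarith
  have "(\<lambda>n. \<integral>\<^sup>+x. ennreal \<bar>f x - h n x\<bar> * indicator {-K..K} x \<partial>lborel)
          \<longlonglongrightarrow> (\<integral>\<^sup>+x. 0 \<partial>(lborel :: real measure))"
  proof (rule nn_integral_dominated_convergence[where w="\<lambda>x. ennreal B * indicator {-K..K} x"])
    show "(\<integral>\<^sup>+x. ennreal B * indicator {-K..K} x \<partial>lborel) < \<infinity>"
      by (auto simp: nn_integral_cmult_indicator ennreal_mult_less_top
          emeasure_lborel_Icc_eq)
    show "AE x in lborel. ennreal \<bar>f x - h n x\<bar> * indicator {-K..K} x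
            \<le> ennreal B * indicator {-K..K} x" for n
    proof (intro AE_I2 mult_right_mono ennreal_leI)
      fix x show "\<bar>f x - h n x\<bar> \<le> B"
        using f0[of x] fB[of x] h0[of n x] hB[of n x] by linarith
    qed simp
  qed (use ae in auto)
  then have "\<forall>\<^sub>F n in sequentially.
      (\<integral>\<^sup>+x. ennreal \<bar>f x - h n x\<bar> * indicator {-K..K} x \<partial>lborel) < ennreal \<eta>"
    using \<open>0 < \<eta>\<close> by (intro order_tendstoD(2)) auto
  then obtain n where "(\<integral>\<^sup>+x. ennreal \<bar>f x - h n x\<bar> * indicator {-K..K} x \<partial>lborel) < ennreal \<eta>"
    by (auto simp: eventually_sequentially)
  then show ?thesis using h_cont by (intro exI[of _ "h n"]) auto
qed

text \<open>
  For a continuous \<open>g\<close> the claim is uniform continuity on a bounded interval, outside of which \<open>\<mu>\<close> has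
  little mass.  Replacing \<open>f\<close> by such a \<open>g\<close> costs \<open>\<bar>f - g\<bar>\<close> at the centre and its integral over the window.
  Both are small in mean: \<open>\<mu>\<close> is at most \<open>B\<close> times Lebesgue measure, and by Tonelli's theorem the average over
  the centre of the integrals over windows of length \<open>2h\<close> is \<open>2h\<close> times an integral of \<open>\<bar>f - g\<bar>\<close>.
\<close>

lemma lebesgue_points_in_mean:
  fixes f :: "real \<Rightarrow> real"
  assumes [measurable]: "f \<in> borel_measurable borel"
    and f0: "\<And>x. 0 \<le> f x" and fB: "\<And>x. f x \<le> B" and B: "0 < B" and \<eta>: "0 < \<eta>"
    and "prob_space (density lborel (\<lambda>x. ennreal (f x)))"
  shows "\<exists>h0>0. \<forall>h. 0 < h \<and> h \<le> h0 \<longrightarrow>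
           (\<integral>\<^sup>+x. (\<integral>\<^sup>+y. ennreal \<bar>f y - f x\<bar> * indicator {x-h..x+h} y \<partial>lborel)
              \<partial>density lborel (\<lambda>x. ennreal (f x))) \<le> ennreal (\<eta> * h)"
proof -
  define \<mu> where "\<mu> = density lborel (\<lambda>x. ennreal (f x))"
  interpret \<mu>: prob_space \<mu> using assms(6) by (simp add: \<mu>_def)
  have [simp]: "sets \<mu> = sets borel" "space \<mu> = UNIV" by (auto simp: \<mu>_def)
  have le_lborel: "(\<integral>\<^sup>+x. u x \<partial>\<mu>) \<le> ennreal B * (\<integral>\<^sup>+x. u x \<partial>lborel)"
    if [measurable]: "u \<in> borel_measurable borel" for u
  proof -
    have "(\<integral>\<^sup>+x. u x \<partial>\<mu>) = (\<integral>\<^sup>+x. ennreal (f x) * u x \<partial>lborel)"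
      unfolding \<mu>_def by (simp add: nn_integral_density)
    also have "\<dots> \<le> (\<integral>\<^sup>+x. ennreal B * u x \<partial>lborel)"
      by (intro nn_integral_mono mult_right_mono ennreal_leI fB) simp
    finally show ?thesis by (simp add: nn_integral_cmult)
  qed
  \<comment> \<open>The constants make the four error terms below add up to \<open>3/4 * \<eta> * h\<close>.\<close>
  obtain K :: nat where K: "\<mu>.prob (UNIV - {-real K..real K}) \<le> \<eta> / (8 * B)"
  proof -
    have "(\<lambda>n. \<mu>.prob (UNIV - {-real n..real n})) \<longlonglongrightarrow> \<mu>.prob (\<Inter>n. UNIV - {-real n..real n})"
      by (intro \<mu>.finite_Lim_measure_decseq) (auto simp: decseq_def)
    also have "(\<Inter>n. UNIV - {-real n..real n}) = {}"
    proof -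
      have "\<exists>n. x \<in> {-real n..real n}" for x
      proof -
        obtain n where "\<bar>x\<bar> \<le> real n" using real_arch_simple by blast
        then show ?thesis by (intro exI[of _ n]) auto
      qed
      then show ?thesis by blast
    qed
    finally have "\<forall>\<^sub>F n in sequentially. \<mu>.prob (UNIV - {-real n..real n}) < \<eta> / (8 * B)"
      using B \<eta> by (intro order_tendstoD(2)) auto
    then obtain n where "\<mu>.prob (UNIV - {-real n..real n}) < \<eta> / (8 * B)"
      by (auto simp: eventually_sequentially)
    then show ?thesis using that[of n] by simp
  qed
  \<comment> \<open>Windows of radius at most 1 with centre in \<open>[-K, K]\<close> stay inside \<open>[-L, L]\<close>.\<close>
  define L where "L = real K + 1"
  obtain g where g: "continuous_on UNIV g"
    and fg: "(\<integral>\<^sup>+x. ennreal \<bar>f x - g x\<bar> * indicator {-L..L} x \<partial>lborel) \<le> ennreal (\<eta> / (16 * B))"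
    using continuous_approx_L1[of f B "\<eta> / (16 * B)" L] f0 fB B \<eta> by auto
  have [measurable]: "g \<in> borel_measurable borel"
    by (rule borel_measurable_continuous_onI[OF g])
  have "uniformly_continuous_on {-L..L} g"
    by (intro compact_uniformly_continuous continuous_on_subset[OF g]) auto
  have "0 < \<eta> / 8" using \<eta> by simp
  with \<open>uniformly_continuous_on {-L..L} g\<close> obtain d where d: "d > 0"
    and d_unif: "\<forall>x\<in>{-L..L}. \<forall>y\<in>{-L..L}. dist y x < d \<longrightarrow> dist (g y) (g x) < \<eta> / 8"
    unfolding uniformly_continuous_on_def by meson
  have g_close: "\<bar>g y - g x\<bar> < \<eta> / 8"
    if "x \<in> {-L..L}" "y \<in> {-L..L}" "\<bar>y - x\<bar> < d" for x y
    using d_unif[rule_format, of x y] that by (simp add: dist_real_def)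
  define D where "D = (\<lambda>y. \<bar>f y - g y\<bar> * indicator {-L..L} y)"
  have [measurable]: "D \<in> borel_measurable borel" unfolding D_def by measurable
  have D0: "0 \<le> D y" for y by (simp add: D_def)
  have D_int: "(\<integral>\<^sup>+y. ennreal (D y) \<partial>lborel) \<le> ennreal (\<eta> / (16 * B))"
    using fg by (simp add: D_def ennreal_mult' ennreal_indicator)
  show ?thesis unfolding \<mu>_def[symmetric]
  proof (intro exI[of _ "min (d/2) 1"] conjI allI impI)
    show "0 < min (d/2) 1" using d by simp
    fix h assume h: "0 < h \<and> h \<le> min (d/2) 1"
    then have h0: "0 < h" "h \<le> 1" "h < d" using d by auto
    define O' where "O' = UNIV - {-real K..real K}"
    have [measurable]: "O' \<in> sets borel" by (simp add: O'_def)
    have pw: "(\<integral>\<^sup>+y. ennreal \<bar>f y - f x\<bar> * indicator {x-h..x+h} y \<partial>lborel)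
        \<le> ennreal (2*h*B) * indicator O' x
          + (\<integral>\<^sup>+y. ennreal (D y) * indicator {x-h..x+h} y \<partial>lborel)
          + ennreal (2*h*(\<eta>/8)) + ennreal (2*h) * ennreal (D x)" (is "?Q \<le> ?R") for x
    proof (cases "x \<in> O'")
      case True
      have "?Q \<le> (\<integral>\<^sup>+y. ennreal B * indicator {x-h..x+h} y \<partial>lborel)"
      proof (intro nn_integral_mono mult_right_mono ennreal_leI)
        fix y show "\<bar>f y - f x\<bar> \<le> B"
          using f0[of x] fB[of x] f0[of y] fB[of y] by linarith
      qed simp
      also have "\<dots> = ennreal (2*h*B)"
        using h0 B by (simp add: nn_integral_cmult_indicator ennreal_mult'[symmetric] mult_ac)
      also have "\<dots> \<le> ?R" using True by (simp add: add_increasing2)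
      finally show ?thesis .
    next
      case False
      then have xK: "x \<in> {-real K..real K}" by (auto simp: O'_def)
      have xL: "x \<in> {-L..L}" using xK by (auto simp: L_def)
      have "?Q \<le> (\<integral>\<^sup>+y. ennreal (D y) * indicator {x-h..x+h} y
                       + ennreal (\<eta>/8 + D x) * indicator {x-h..x+h} y \<partial>lborel)"
      proof (rule nn_integral_mono)
        fix y
        show "ennreal \<bar>f y - f x\<bar> * indicator {x-h..x+h} y
          \<le> ennreal (D y) * indicator {x-h..x+h} y + ennreal (\<eta>/8 + D x) * indicator {x-h..x+h} y"
        proof (cases "y \<in> {x-h..x+h}")
          case y: True
          have yL: "y \<in> {-L..L}" using y xK h0 by (auto simp: L_def)
          have "\<bar>g y - g x\<bar> < \<eta>/8" using y h0 by (intro g_close xL yL) auto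
          moreover have "\<bar>a + b - c\<bar> \<le> \<bar>a\<bar> + \<bar>b\<bar> + \<bar>c\<bar>" for a b c :: real by linarith
          from this[of "f y - g y" "g y - g x" "f x - g x"]
          have "\<bar>f y - f x\<bar> \<le> D y + \<bar>g y - g x\<bar> + D x"
            using xL yL by (simp add: D_def)
          ultimately have "\<bar>f y - f x\<bar> \<le> D y + (\<eta>/8 + D x)" by linarith
          then show ?thesis using y D0[of x] D0[of y] \<eta>
            by (simp add: ennreal_plus[symmetric] del: ennreal_plus)
        qed simp
      qed
      also have "\<dots> = (\<integral>\<^sup>+y. ennreal (D y) * indicator {x-h..x+h} y \<partial>lborel)
                      + ennreal (\<eta>/8 + D x) * ennreal (2*h)"
        using h0 by (simp add: nn_integral_add nn_integral_cmult_indicator)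
      also have "\<dots> = (\<integral>\<^sup>+y. ennreal (D y) * indicator {x-h..x+h} y \<partial>lborel)
                      + (ennreal (2*h*(\<eta>/8)) + ennreal (2*h) * ennreal (D x))"
        using h0 D0[of x] \<eta> by (simp add: ennreal_mult''[symmetric] ennreal_plus[symmetric] algebra_simps del: ennreal_plus)
      also have "\<dots> \<le> ?R" by (simp add: add.assoc add_increasing)
      finally show ?thesis .
    qed
    have ind_eq: "indicator {x-h..x+h} y = (if x - h \<le> y \<and> y \<le> x + h then 1 else 0 :: ennreal)" for x y
      by (auto simp: indicator_def)
    have inner_meas [measurable]: "(\<lambda>x. \<integral>\<^sup>+y. ennreal (D y) * indicator {x-h..x+h} y \<partial>lborel) \<in> borel_measurable borel"
    proof -
      have "(\<lambda>x. \<integral>\<^sup>+y. ennreal (D y) * (if x - h \<le> y \<and> y \<le> x + h then 1 else 0) \<partial>lborel)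
             \<in> borel_measurable borel" by measurable
      then show ?thesis by (simp add: ind_eq)
    qed
    have "(\<integral>\<^sup>+x. (\<integral>\<^sup>+y. ennreal (D y) * indicator {x-h..x+h} y \<partial>lborel) \<partial>\<mu>)
        \<le> ennreal B * (\<integral>\<^sup>+x. (\<integral>\<^sup>+y. ennreal (D y) * indicator {x-h..x+h} y \<partial>lborel) \<partial>lborel)"
      by (intro le_lborel inner_meas)
    also have "(\<integral>\<^sup>+x. (\<integral>\<^sup>+y. ennreal (D y) * indicator {x-h..x+h} y \<partial>lborel) \<partial>lborel)
        = (\<integral>\<^sup>+x. (\<integral>\<^sup>+y. ennreal (D y) * (if x - h \<le> y \<and> y \<le> x + h then 1 else 0) \<partial>lborel) \<partial>lborel)"
      by (simp add: ind_eq)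
    also have "\<dots> = (\<integral>\<^sup>+y. (\<integral>\<^sup>+x. ennreal (D y) * (if x - h \<le> y \<and> y \<le> x + h then 1 else 0) \<partial>lborel) \<partial>lborel)"
      by (rule lborel_pair.Fubini') measurable
    also have "\<dots> = (\<integral>\<^sup>+y. ennreal (D y) * ennreal (2*h) \<partial>lborel)"
    proof (rule nn_integral_cong)
      fix y
      have "(\<integral>\<^sup>+x. ennreal (D y) * (if x - h \<le> y \<and> y \<le> x + h then 1 else 0) \<partial>lborel)
          = (\<integral>\<^sup>+x. ennreal (D y) * indicator {y-h..y+h} x \<partial>lborel)"
        by (intro nn_integral_cong) (auto simp: indicator_def)
      then show "(\<integral>\<^sup>+x. ennreal (D y) * (if x - h \<le> y \<and> y \<le> x + h then 1 else 0) \<partial>lborel)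
          = ennreal (D y) * ennreal (2*h)"
        using h0 by (simp add: nn_integral_cmult_indicator)
    qed
    also have "\<dots> \<le> ennreal (\<eta> / (16 * B)) * ennreal (2*h)"
      using D_int by (simp add: nn_integral_multc mult_right_mono)
    also have "ennreal B * \<dots> = ennreal (h * \<eta> / 8)"
      using B \<eta> h0 by (simp add: ennreal_mult'[symmetric] ennreal_mult''[symmetric] field_simps)
    finally have I2: "(\<integral>\<^sup>+x. (\<integral>\<^sup>+y. ennreal (D y) * indicator {x-h..x+h} y \<partial>lborel) \<partial>\<mu>)
        \<le> ennreal (h * \<eta> / 8)" by (simp add: mult_left_mono)
    have "ennreal (2*h) * (\<integral>\<^sup>+x. ennreal (D x) \<partial>\<mu>) \<le> ennreal (2*h) * (ennreal B * ennreal (\<eta> / (16 * B)))"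
      by (intro mult_left_mono order.trans[OF le_lborel] D_int) auto
    also have "\<dots> = ennreal (h * \<eta> / 8)"
      using B \<eta> h0 by (simp add: ennreal_mult'[symmetric] ennreal_mult''[symmetric] field_simps)
    finally have I4: "ennreal (2*h) * (\<integral>\<^sup>+x. ennreal (D x) \<partial>\<mu>) \<le> ennreal (h * \<eta> / 8)" .
    have "ennreal (2*h*B) * emeasure \<mu> O' \<le> ennreal (2*h*B) * ennreal (\<eta> / (8*B))"
      using K by (intro mult_left_mono) (auto simp: \<mu>.emeasure_eq_measure O'_def ennreal_leI)
    also have "\<dots> = ennreal (h * \<eta> / 4)"
      using B \<eta> h0 by (simp add: ennreal_mult'[symmetric] ennreal_mult''[symmetric] field_simps)
    finally have I1: "ennreal (2*h*B) * emeasure \<mu> O' \<le> ennreal (h * \<eta> / 4)" .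
    have "(\<integral>\<^sup>+x. (\<integral>\<^sup>+y. ennreal \<bar>f y - f x\<bar> * indicator {x-h..x+h} y \<partial>lborel) \<partial>\<mu>)
       \<le> (\<integral>\<^sup>+x. ennreal (2*h*B) * indicator O' x
          + (\<integral>\<^sup>+y. ennreal (D y) * indicator {x-h..x+h} y \<partial>lborel)
          + ennreal (2*h*(\<eta>/8)) + ennreal (2*h) * ennreal (D x) \<partial>\<mu>)"
      by (intro nn_integral_mono pw)
    also have "\<dots> = ennreal (2*h*B) * emeasure \<mu> O'
          + (\<integral>\<^sup>+x. (\<integral>\<^sup>+y. ennreal (D y) * indicator {x-h..x+h} y \<partial>lborel) \<partial>\<mu>)
          + ennreal (2*h*(\<eta>/8)) + ennreal (2*h) * (\<integral>\<^sup>+x. ennreal (D x) \<partial>\<mu>)"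
      by (simp add: nn_integral_add nn_integral_cmult nn_integral_cmult_indicator \<mu>.emeasure_space_1[simplified]
          measurable_cong_sets[OF \<open>sets \<mu> = sets borel\<close> refl])
    also have "\<dots> \<le> ennreal (h * \<eta> / 4) + ennreal (h * \<eta> / 8) + ennreal (2*h*(\<eta>/8)) + ennreal (h * \<eta> / 8)"
      by (intro add_mono I1 I2 I4 order_refl)
    also have "\<dots> = ennreal (3/4 * (\<eta> * h))"
      using \<eta> h0 by (simp add: ennreal_plus[symmetric] field_simps del: ennreal_plus)
    also have "\<dots> \<le> ennreal (\<eta> * h)" using \<eta> h0 by (intro ennreal_leI) simp
    finally show "(\<integral>\<^sup>+x. (\<integral>\<^sup>+y. ennreal \<bar>f y - f x\<bar> * indicator {x-h..x+h} y \<partial>lborel) \<partial>\<mu>)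
        \<le> ennreal (\<eta> * h)" .
  qed
qed

section \<open>Counting the neighbours of a sample point\<close>

text \<open>
  A set \<open>W\<close> of pairs serves as a family of windows: its section at \<open>a\<close> is the window with centre \<open>a\<close>.
\<close>

definition near_count :: "nat \<Rightarrow> (nat \<Rightarrow> real) \<Rightarrow> (real \<times> real) set \<Rightarrow> nat \<Rightarrow> nat" where
  "near_count n x W j = card {l \<in> {1..n} - {j}. (x j, x l) \<in> W}"

lemma near_count_eq_sum:
  "near_count n x W j = (\<Sum>l\<in>{1..n}-{j}. if (x j, x l) \<in> W then 1 else 0)"
  by (simp add: near_count_def sum.If_cases Int_def)

lemma measurable_near_count [measurable]:
  assumes [measurable]: "\<And>i. i \<in> {1..n} \<Longrightarrow> Xs i \<in> borel_measurable N" "W \<in> sets (borel \<Otimes>\<^sub>M borel)"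
    and j: "j \<in> {1..n}"
  shows "(\<lambda>\<omega>. near_count n (\<lambda>i. Xs i \<omega>) W j) \<in> measurable N (count_space UNIV)"
proof -
  have [measurable]: "Xs j \<in> borel_measurable N" using j by (rule assms)
  have "(\<lambda>\<omega>. if (Xs j \<omega>, Xs l \<omega>) \<in> W then 1 else 0 :: nat) \<in> measurable N (count_space UNIV)"
    if "l \<in> {1..n} - {j}" for l
  proof -
    have [measurable]: "Xs l \<in> borel_measurable N" using that by (intro assms) auto
    show ?thesis by measurable
  qed
  then show ?thesis unfolding near_count_eq_sum
    by (intro measurable_sum_nat)
qed

text \<open>
  Fubini's theorem for the product law of the sample: conditionally on the centre, the contributions of the
  other points are independent, so their expectations multiply.
\<close>

lemma nn_integral_decouple:
  fixes Xs :: "nat \<Rightarrow> 'b \<Rightarrow> real" and \<mu> :: "real measure"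
  assumes "prob_space N" and ind: "prob_space.indep_vars N (\<lambda>_. borel) Xs I"
    and I: "finite I" "j \<in> I" and dist: "\<And>i. i \<in> I \<Longrightarrow> distr N borel (Xs i) = \<mu>"
    and [measurable]: "u \<in> borel_measurable borel"
      "case_prod k \<in> borel_measurable (borel \<Otimes>\<^sub>M borel)"
  shows "(\<integral>\<^sup>+\<omega>. u (Xs j \<omega>) * (\<Prod>l\<in>I-{j}. k (Xs j \<omega>) (Xs l \<omega>)) \<partial>N)
       = (\<integral>\<^sup>+x. u x * (\<integral>\<^sup>+y. k x y \<partial>\<mu>) ^ (card I - 1) \<partial>\<mu>)"
proof -
  interpret N: prob_space N by fact
  have rv: "Xs i \<in> borel_measurable N" if "i \<in> I" for i
    using ind that by (auto simp: N.indep_vars_def)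
  interpret \<mu>: prob_space \<mu>
    using N.prob_space_distr[OF rv[OF I(2)]] dist[OF I(2)] by simp
  have [measurable_cong, simp]: "sets \<mu> = sets borel" using dist[OF I(2)] by auto
  have [simp]: "space \<mu> = UNIV" using sets_eq_imp_space_eq[OF \<open>sets \<mu> = sets borel\<close>] by simp
  interpret P: product_sigma_finite "\<lambda>_. \<mu>" by standard
  define G where "G = (\<lambda>z. u (z j) * (\<Prod>l\<in>I-{j}. k (z j) (z l)))"
  have G [measurable]: "G \<in> borel_measurable (PiM I (\<lambda>_. borel))"
  proof -
    have [measurable]: "(\<lambda>z. z j) \<in> borel_measurable (PiM I (\<lambda>_. borel :: real measure))"
      using I by measurable
    have "(\<lambda>z. k (z j) (z l)) \<in> borel_measurable (PiM I (\<lambda>_. borel :: real measure))" if "l \<in> I - {j}" for l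
    proof -
      have [measurable]: "(\<lambda>z. z l) \<in> borel_measurable (PiM I (\<lambda>_. borel :: real measure))"
        using that by (intro measurable_component_singleton) auto
      show ?thesis by measurable
    qed
    then show ?thesis unfolding G_def by measurable
  qed
  have Y: "(\<lambda>\<omega>. \<lambda>i\<in>I. Xs i \<omega>) \<in> measurable N (PiM I (\<lambda>_. borel))"
    using rv by (intro measurable_restrict) auto
  have "distr N (PiM I (\<lambda>_. borel)) (\<lambda>\<omega>. \<lambda>i\<in>I. Xs i \<omega>) = PiM I (\<lambda>i. distr N borel (Xs i))"
    using ind I(2) rv by (subst (asm) N.indep_vars_iff_distr_eq_PiM') auto
  also have "\<dots> = PiM I (\<lambda>_. \<mu>)" by (intro PiM_cong dist refl)
  finally have D: "distr N (PiM I (\<lambda>_. borel)) (\<lambda>\<omega>. \<lambda>i\<in>I. Xs i \<omega>) = PiM I (\<lambda>_. \<mu>)" .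
  have "(\<integral>\<^sup>+\<omega>. u (Xs j \<omega>) * (\<Prod>l\<in>I-{j}. k (Xs j \<omega>) (Xs l \<omega>)) \<partial>N) = (\<integral>\<^sup>+\<omega>. G (\<lambda>i\<in>I. Xs i \<omega>) \<partial>N)"
    unfolding G_def using I by simp
  also have "\<dots> = (\<integral>\<^sup>+z. G z \<partial>PiM I (\<lambda>_. \<mu>))"
    unfolding D[symmetric] using Y by (simp add: nn_integral_distr)
  also have "\<dots> = (\<integral>\<^sup>+z. G z \<partial>PiM (insert j (I - {j})) (\<lambda>_. \<mu>))"
    using I by (simp add: insert_absorb)
  also have "\<dots> = (\<integral>\<^sup>+x. (\<integral>\<^sup>+z. G (z(j := x)) \<partial>PiM (I - {j}) (\<lambda>_. \<mu>)) \<partial>\<mu>)"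
  proof (rule P.product_nn_integral_insert_rev)
    have "sets (PiM I (\<lambda>_. \<mu>)) = sets (PiM I (\<lambda>_. borel))" by (intro sets_PiM_cong) auto
    then have "G \<in> borel_measurable (PiM I (\<lambda>_. \<mu>))" using G by (simp cong: measurable_cong_sets)
    then show "G \<in> borel_measurable (PiM (insert j (I - {j})) (\<lambda>_. \<mu>))"
      using I by (simp add: insert_absorb)
  qed (use I in auto)
  also have "\<dots> = (\<integral>\<^sup>+x. u x * (\<integral>\<^sup>+y. k x y \<partial>\<mu>) ^ (card I - 1) \<partial>\<mu>)"
  proof (rule nn_integral_cong)
    fix x
    have km: "k x \<in> borel_measurable \<mu>" by measurable
    have "(\<integral>\<^sup>+z. G (z(j := x)) \<partial>PiM (I - {j}) (\<lambda>_. \<mu>))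
        = (\<integral>\<^sup>+z. u x * (\<Prod>l\<in>I-{j}. k x (z l)) \<partial>PiM (I - {j}) (\<lambda>_. \<mu>))"
      unfolding G_def by (intro nn_integral_cong arg_cong2[where f="(*)"] prod.cong) auto
    also have "\<dots> = u x * (\<integral>\<^sup>+z. (\<Prod>l\<in>I-{j}. k x (z l)) \<partial>PiM (I - {j}) (\<lambda>_. \<mu>))"
    proof (rule nn_integral_cmult)
      show "(\<lambda>z. \<Prod>l\<in>I-{j}. k x (z l)) \<in> borel_measurable (PiM (I - {j}) (\<lambda>_. \<mu>))"
        by (intro borel_measurable_prod_ennreal measurable_compose[OF _ km] measurable_component_singleton)
    qed
    also have "(\<integral>\<^sup>+z. (\<Prod>l\<in>I-{j}. k x (z l)) \<partial>PiM (I - {j}) (\<lambda>_. \<mu>)) = (\<Prod>l\<in>I-{j}. \<integral>\<^sup>+y. k x y \<partial>\<mu>)"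
      using I km by (intro P.product_nn_integral_prod) auto
    also have "(\<Prod>l\<in>I-{j}. \<integral>\<^sup>+y. k x y \<partial>\<mu>) = (\<integral>\<^sup>+y. k x y \<partial>\<mu>) ^ (card I - 1)"
      using I by (simp add: card_Diff_singleton)
    finally show "(\<integral>\<^sup>+z. G (z(j := x)) \<partial>PiM (I - {j}) (\<lambda>_. \<mu>)) = u x * (\<integral>\<^sup>+y. k x y \<partial>\<mu>) ^ (card I - 1)" .
  qed
  finally show ?thesis .
qed

text \<open>
  Chernoff's method with base \<open>r = 1/q\<close>: conditionally on the centre, \<open>r ^ near_count\<close> has expectation at most
  \<open>exp ((n - 1) p (r - 1))\<close> for a window of mass \<open>p\<close>, and Markov's inequality divides this by \<open>r ^ m\<close>.
  Stating event and hypothesis through \<open>r\<close> covers both tails.  For \<open>q < 1\<close> the hypothesis says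
  \<open>(n - 1) p \<le> q m\<close> and the event contains \<open>near_count \<ge> m\<close>; for \<open>q > 1\<close> it says \<open>(n - 1) p \<ge> q m\<close> and the
  event contains \<open>near_count \<le> m\<close>.
\<close>

lemma near_count_chernoff:
  fixes Xs :: "nat \<Rightarrow> 'b \<Rightarrow> real" and \<mu> :: "real measure"
  assumes "prob_space N" and ind: "prob_space.indep_vars N (\<lambda>_. borel) Xs {1..n}"
    and j: "j \<in> {1..n}" and dist: "\<And>i. i \<in> {1..n} \<Longrightarrow> distr N borel (Xs i) = \<mu>"
    and W[measurable]: "W \<in> sets (borel \<Otimes>\<^sub>M borel)" and C[measurable]: "C \<in> sets borel"
    and q: "0 < q"
    and mean: "\<And>x. x \<in> C \<Longrightarrow> (real n - 1) * measure \<mu> {y. (x, y) \<in> W} * (1 / q - 1) \<le> real m * (1 - q)"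
  shows "emeasure N {\<omega> \<in> space N. Xs j \<omega> \<in> C \<and>
           (1 / q) ^ m \<le> (1 / q) ^ near_count n (\<lambda>i. Xs i \<omega>) W j} \<le> ennreal ((q * exp (1 - q)) ^ m)"
proof -
  interpret N: prob_space N by fact
  have rv: "Xs i \<in> borel_measurable N" if "i \<in> {1..n}" for i
    using ind that by (auto simp: N.indep_vars_def)
  note [measurable] = rv[OF j]
  interpret \<mu>: prob_space \<mu>
    using N.prob_space_distr[OF rv[OF j]] dist[OF j] by simp
  have [measurable_cong, simp]: "sets \<mu> = sets borel" using dist[OF j] by auto
  have [simp]: "space \<mu> = UNIV" using sets_eq_imp_space_eq[OF \<open>sets \<mu> = sets borel\<close>] by simp
  define r where "r = 1 / q"
  have r: "0 < r" using q by (simp add: r_def)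
  define k where "k = (\<lambda>x y. if (x, y) \<in> W then ennreal r else 1)"
  have [measurable]: "case_prod k \<in> borel_measurable (borel \<Otimes>\<^sub>M borel)"
    unfolding k_def by measurable
  define cnt where "cnt = (\<lambda>\<omega>. near_count n (\<lambda>i. Xs i \<omega>) W j)"
  have [measurable]: "cnt \<in> measurable N (count_space UNIV)"
    unfolding cnt_def using rv j by (intro measurable_near_count W)
  have prod_k: "(\<Prod>l\<in>{1..n}-{j}. k (Xs j \<omega>) (Xs l \<omega>)) = ennreal (r ^ cnt \<omega>)" for \<omega>
    unfolding k_def cnt_def near_count_def using r
    by (simp add: prod.If_cases Int_def ennreal_power)
  have k_int: "(\<integral>\<^sup>+y. k x y \<partial>\<mu>) \<le> ennreal (exp (measure \<mu> {y. (x, y) \<in> W} * (r - 1)))" for x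
  proof -
    have Wx [measurable]: "{y. (x, y) \<in> W} \<in> sets borel" by measurable
    define p where "p = measure \<mu> {y. (x, y) \<in> W}"
    have p: "0 \<le> p" "p \<le> 1" by (auto simp: p_def)
    have "(\<integral>\<^sup>+y. k x y \<partial>\<mu>) = (\<integral>\<^sup>+y. ennreal r * indicator {y. (x, y) \<in> W} y + indicator (- {y. (x, y) \<in> W}) y \<partial>\<mu>)"
      by (intro nn_integral_cong) (auto simp: k_def indicator_def)
    also have "\<dots> = ennreal r * emeasure \<mu> {y. (x, y) \<in> W} + emeasure \<mu> (- {y. (x, y) \<in> W})"
      by (simp add: nn_integral_add nn_integral_cmult_indicator)
    also have "\<dots> = ennreal (r * p + (1 - p))"
      using \<mu>.prob_compl[of "{y. (x, y) \<in> W}"] p r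
      by (simp add: \<mu>.emeasure_eq_measure Compl_eq_Diff_UNIV p_def[symmetric] ennreal_mult')
    also have "\<dots> \<le> ennreal (exp (p * (r - 1)))"
      using exp_ge_add_one_self[of "p * (r - 1)"] by (intro ennreal_leI) (simp add: algebra_simps)
    finally show ?thesis by (simp add: p_def)
  qed
  have "emeasure N {\<omega> \<in> space N. Xs j \<omega> \<in> C \<and> r ^ m \<le> r ^ cnt \<omega>}
      = (\<integral>\<^sup>+\<omega>. indicator {\<omega> \<in> space N. Xs j \<omega> \<in> C \<and> r ^ m \<le> r ^ cnt \<omega>} \<omega> \<partial>N)"
    by (intro nn_integral_indicator[symmetric]) measurable
  also have "\<dots> \<le> (\<integral>\<^sup>+\<omega>. ennreal (q ^ m) * indicator C (Xs j \<omega>) * (\<Prod>l\<in>{1..n}-{j}. k (Xs j \<omega>) (Xs l \<omega>)) \<partial>N)"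
  proof (rule nn_integral_mono)
    fix \<omega>
    show "indicator {\<omega> \<in> space N. Xs j \<omega> \<in> C \<and> r ^ m \<le> r ^ cnt \<omega>} \<omega>
      \<le> ennreal (q ^ m) * indicator C (Xs j \<omega>) * (\<Prod>l\<in>{1..n}-{j}. k (Xs j \<omega>) (Xs l \<omega>))"
    proof (cases "Xs j \<omega> \<in> C \<and> r ^ m \<le> r ^ cnt \<omega>")
      case True
      then have "q ^ m * r ^ m \<le> q ^ m * r ^ cnt \<omega>" using q by (intro mult_left_mono) auto
      moreover have "q ^ m * r ^ m = 1" using q by (simp add: r_def power_mult_distrib[symmetric])
      ultimately have "ennreal 1 \<le> ennreal (q ^ m) * ennreal (r ^ cnt \<omega>)"
        using q r by (simp add: ennreal_mult[symmetric])
      then show ?thesis unfolding prod_k using True by (auto simp: indicator_def)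
    qed (auto simp: indicator_def)
  qed
  also have "\<dots> = (\<integral>\<^sup>+x. ennreal (q ^ m) * indicator C x * (\<integral>\<^sup>+y. k x y \<partial>\<mu>) ^ (card {1..n} - 1) \<partial>\<mu>)"
    by (rule nn_integral_decouple[OF assms(1) ind _ j dist]) measurable
  also have "\<dots> \<le> (\<integral>\<^sup>+x. ennreal ((q * exp (1 - q)) ^ m) \<partial>\<mu>)"
  proof (rule nn_integral_mono)
    fix x
    show "ennreal (q ^ m) * indicator C x * (\<integral>\<^sup>+y. k x y \<partial>\<mu>) ^ (card {1..n} - 1) \<le> ennreal ((q * exp (1 - q)) ^ m)"
    proof (cases "x \<in> C")
      case True
      have "(\<integral>\<^sup>+y. k x y \<partial>\<mu>) ^ (card {1..n} - 1)
          \<le> ennreal (exp (measure \<mu> {y. (x, y) \<in> W} * (r - 1))) ^ (n - 1)"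
        using k_int[of x] by (simp add: power_mono)
      also have "\<dots> = ennreal (exp ((real n - 1) * (measure \<mu> {y. (x, y) \<in> W} * (r - 1))))"
        using j by (simp add: ennreal_power exp_of_nat_mult[symmetric] of_nat_diff)
      also have "\<dots> \<le> ennreal (exp (real m * (1 - q)))"
        using mean[OF True] by (intro ennreal_leI) (simp add: r_def mult.assoc)
      finally have "ennreal (q ^ m) * (\<integral>\<^sup>+y. k x y \<partial>\<mu>) ^ (card {1..n} - 1) \<le> ennreal (q ^ m) * ennreal (exp (real m * (1 - q)))"
        by (intro mult_left_mono) auto
      also have "\<dots> = ennreal ((q * exp (1 - q)) ^ m)"
        using q by (simp add: ennreal_mult[symmetric] power_mult_distrib exp_of_nat_mult)
      finally show ?thesis using True by simp
    qed simp
  qed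
  also have "\<dots> = ennreal ((q * exp (1 - q)) ^ m)" using \<mu>.emeasure_space_1 by simp
  finally show ?thesis by (simp add: r_def cnt_def)
qed

section \<open>Order statistics and neighbour counts\<close>

text \<open>
  Sorting the indices by their values, instead of the values, yields the permutation of ranks, also in the
  presence of ties.
\<close>

lemma order_stat_eq_permuted:
  obtains \<sigma> where "bij_betw \<sigma> {1..n} {1..n}"
    and "\<And>i. i \<in> {1..n} \<Longrightarrow> order_stat n x (int i) = x (\<sigma> i)"
    and "\<And>i k. 1 \<le> i \<Longrightarrow> i \<le> k \<Longrightarrow> k \<le> n \<Longrightarrow> x (\<sigma> i) \<le> x (\<sigma> k)"
proof -
  define ys where "ys = sort_key x [1..<Suc n]"
  have len: "length ys = n" by (simp add: ys_def)
  have srt: "sort (map x [1..<Suc n]) = map x ys"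
    by (rule properties_for_sort) (simp_all add: ys_def)
  have "bij_betw (\<lambda>i. ys ! i) {..<n} (set ys)"
    using len by (intro bij_betw_nth) (auto simp: ys_def)
  moreover have "bij_betw (\<lambda>i. i - 1) {1..n} {..<n}"
    by (rule bij_betw_byWitness[where f'="\<lambda>i. i + 1"]) auto
  ultimately have "bij_betw ((\<lambda>i. ys ! i) \<circ> (\<lambda>i. i - 1)) {1..n} (set ys)"
    by (blast intro: bij_betw_trans)
  moreover have "set ys = {1..n}" by (auto simp: ys_def)
  ultimately have 1: "bij_betw (\<lambda>i. ys ! (i - 1)) {1..n} {1..n}" by (simp add: o_def)
  have 2: "order_stat n x (int i) = x (ys ! (i - 1))" if "i \<in> {1..n}" for i
    unfolding order_stat_def srt Let_def using that len by (auto simp: nat_diff_distrib)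
  have "sorted (map x ys)" by (simp add: ys_def)
  then have 3: "x (ys ! (i - 1)) \<le> x (ys ! (k - 1))" if "1 \<le> i" "i \<le> k" "k \<le> n" for i k
    using sorted_nth_mono[of "map x ys" "i - 1" "k - 1"] that len by simp
  show ?thesis using that[OF 1 2 3] .
qed

lemma order_stat_below: "1 \<le> n \<Longrightarrow> i < 1 \<Longrightarrow> order_stat n x i = order_stat n x 1"
  and order_stat_above: "1 \<le> n \<Longrightarrow> int n < i \<Longrightarrow> order_stat n x i = order_stat n x (int n)"
  by (auto simp: order_stat_def Let_def nat_diff_distrib)

definition ball_window :: "real \<Rightarrow> (real \<times> real) set" where
  "ball_window \<delta> = {(a, b). \<bar>b - a\<bar> \<le> \<delta>}"

text \<open>
  One-sided windows of length \<open>h a\<close> at the centre \<open>a\<close>, to the right for \<open>s = 1\<close> and to the left for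
  \<open>s = -1\<close>.  With ties, points equal to the centre must be counted when many neighbours are to be found and
  must not be counted when few are; hence the two variants.
\<close>

definition closed_window :: "real \<Rightarrow> (real \<Rightarrow> real) \<Rightarrow> (real \<times> real) set" where
  "closed_window s h = {(a, b). 0 \<le> s * (b - a) \<and> s * (b - a) \<le> h a}"

definition halfopen_window :: "real \<Rightarrow> (real \<Rightarrow> real) \<Rightarrow> (real \<times> real) set" where
  "halfopen_window s h = {(a, b). 0 < s * (b - a) \<and> s * (b - a) \<le> h a}"

text \<open>
  The necessary condition for a spacing density greater than \<open>t\<close>, or for a vanishing spacing.
\<close>

definition crowded :: "nat \<Rightarrow> nat \<Rightarrow> real \<Rightarrow> (nat \<Rightarrow> real) \<Rightarrow> nat \<Rightarrow> bool" where
  "crowded m n t x j \<longleftrightarrow> m \<le> near_count n x (ball_window (2 * (real m / real n) / t)) j"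

text \<open>
  The necessary condition, at points with \<open>m\<close> others on either side that are not \<open>crowded\<close>, for the spacing
  density to differ from \<open>f\<close> by more than \<open>2\<epsilon>\<close>.  A window of length \<open>m/n\<close> divided by \<open>f a\<close> would contain
  about \<open>m\<close> points; the windows here are made shorter and longer by shifting \<open>f a\<close> by \<open>\<epsilon>\<close>.
\<close>

definition atypical :: "nat \<Rightarrow> nat \<Rightarrow> (real \<Rightarrow> real) \<Rightarrow> real \<Rightarrow> (nat \<Rightarrow> real) \<Rightarrow> nat \<Rightarrow> bool" where
  "atypical m n f \<epsilon> x j \<longleftrightarrow> (\<exists>s\<in>{1, -1}.
     m \<le> near_count n x (closed_window s (\<lambda>a. real m / real n / (f a + \<epsilon>))) j \<or>
     2 * \<epsilon> < f (x j) \<and>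
       near_count n x (halfopen_window s (\<lambda>a. real m / real n / (f a - \<epsilon>))) j \<le> m)"

text \<open>
  A bound for \<open>\<bar>g ^ p - f ^ p\<bar>\<close>, \<open>p = 1, 2\<close>, at all but the boundary ranks, in which every summand depends
  only on the centre and on neighbour counts.
  The \<open>k\<close>-th term of the series pays for spacing densities between \<open>2 ^ k * T\<close> and \<open>2 ^ (k + 1) * T\<close>.
\<close>

definition local_error :: "nat \<Rightarrow> nat \<Rightarrow> (real \<Rightarrow> real) \<Rightarrow> real \<Rightarrow> real \<Rightarrow> (nat \<Rightarrow> real) \<Rightarrow> nat \<Rightarrow> ennreal" where
  "local_error m n f T \<epsilon> x j =
     ennreal (4 * T * \<epsilon>)
     + ennreal (T\<^sup>2) * (if atypical m n f \<epsilon> x j then 1 else 0)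
     + (\<Sum>k. ennreal ((2 ^ (k + 1) * T)\<^sup>2) * (if crowded m n (2 ^ k * T) x j then 1 else 0))"

lemma div_less_swap: "S / t < G \<Longrightarrow> 0 < t \<Longrightarrow> 0 < G \<Longrightarrow> S / G < t"
  and less_div_swap: "t < S / G \<Longrightarrow> 0 < t \<Longrightarrow> 0 < G \<Longrightarrow> G < S / t" for S t G :: real
  by (simp_all add: field_simps)

lemma coef_bounds:
  assumes "0 < m" "i \<in> {1..n}"
  shows "0 \<le> coef m n i" "coef m n i \<le> 2"
  using assms by (auto simp: coef_def divide_simps)

lemma abs_power_diff_le:
  fixes g v :: real
  assumes p: "p \<in> {1, 2 :: nat}" and "0 \<le> g" "g \<le> T" "0 \<le> v" "v \<le> T" "1 \<le> T"
  shows "\<bar>g ^ p - v ^ p\<bar> \<le> 2 * T * \<bar>g - v\<bar>" "\<bar>g ^ p - v ^ p\<bar> \<le> T\<^sup>2"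
proof -
  have sq: "g\<^sup>2 - v\<^sup>2 = (g + v) * (g - v)" by (simp add: power2_eq_square algebra_simps)
  have "(g + v) * \<bar>g - v\<bar> \<le> 2 * T * \<bar>g - v\<bar>" "1 * \<bar>g - v\<bar> \<le> 2 * T * \<bar>g - v\<bar>"
    using assms by (intro mult_right_mono; simp)+
  then show "\<bar>g ^ p - v ^ p\<bar> \<le> 2 * T * \<bar>g - v\<bar>"
    using p assms by (auto simp: sq abs_mult)
  have "g ^ p \<le> T ^ p" "v ^ p \<le> T ^ p" "0 \<le> g ^ p" "0 \<le> v ^ p"
    using assms by (auto intro: power_mono)
  moreover have "T ^ p \<le> T\<^sup>2" using p \<open>1 \<le> T\<close> by (intro power_increasing) auto
  ultimately show "\<bar>g ^ p - v ^ p\<bar> \<le> T\<^sup>2" by linarith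
qed

locale ranked_sample =
  fixes m n :: nat and x :: "nat \<Rightarrow> real" and \<sigma> :: "nat \<Rightarrow> nat"
  assumes m: "0 < m" and mn: "2 * m < n"
    and bij: "bij_betw \<sigma> {1..n} {1..n}"
    and os: "\<And>i. i \<in> {1..n} \<Longrightarrow> order_stat n x (int i) = x (\<sigma> i)"
    and sorted: "\<And>i k. 1 \<le> i \<Longrightarrow> i \<le> k \<Longrightarrow> k \<le> n \<Longrightarrow> x (\<sigma> i) \<le> x (\<sigma> k)"
begin

definition gap :: "nat \<Rightarrow> real" where
  "gap i = order_stat n x (int i + int m) - order_stat n x (int i - int m)"

lemma spacing_density_eq: "spacing_density m n x i = coef m n i * (real m / real n) / gap i"
  by (simp add: spacing_density_def gap_def)

lemma order_stat_plus:
  "i \<in> {1..n} \<Longrightarrow> i + m \<le> n \<Longrightarrow> order_stat n x (int i + int m) = x (\<sigma> (i + m))"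
  using os[of "i + m"] by simp

lemma order_stat_minus:
  "i \<in> {1..n} \<Longrightarrow> m < i \<Longrightarrow> order_stat n x (int i - int m) = x (\<sigma> (i - m))"
  using os[of "i - m"] by (simp add: of_nat_diff Suc_le_eq)

lemma le_order_stat_plus: "i \<in> {1..n} \<Longrightarrow> x (\<sigma> i) \<le> order_stat n x (int i + int m)"
  using order_stat_plus[of i] sorted[of i "i + m"] sorted[of i n]
    order_stat_above[of n "int i + int m" x] os[of n]
  by (cases "i + m \<le> n") auto

lemma order_stat_minus_le: "i \<in> {1..n} \<Longrightarrow> order_stat n x (int i - int m) \<le> x (\<sigma> i)"
  using order_stat_minus[of i] sorted[of "i - m" i] sorted[of 1 i]
    order_stat_below[of n "int i - int m" x] os[of 1]
  by (cases "m < i") auto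

lemma gap_nonneg: "i \<in> {1..n} \<Longrightarrow> 0 \<le> gap i"
  using le_order_stat_plus[of i] order_stat_minus_le[of i] by (simp add: gap_def)

lemma near_count_ge:
  assumes "i \<in> {1..n}" "S \<subseteq> {1..n} - {i}" "\<And>k. k \<in> S \<Longrightarrow> (x (\<sigma> i), x (\<sigma> k)) \<in> W"
  shows "card S \<le> near_count n x W (\<sigma> i)"
proof -
  have inj: "inj_on \<sigma> {1..n}" using bij by (simp add: bij_betw_def)
  have "\<sigma> ` S \<subseteq> {l \<in> {1..n} - {\<sigma> i}. (x (\<sigma> i), x l) \<in> W}"
  proof (rule image_subsetI)
    fix k assume k: "k \<in> S"
    then have "k \<in> {1..n}" "k \<noteq> i" using assms(2) by auto
    then have "\<sigma> k \<noteq> \<sigma> i" using inj assms(1) by (auto dest: inj_onD)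
    moreover have "\<sigma> k \<in> {1..n}" using \<open>k \<in> {1..n}\<close> bij by (auto simp: bij_betw_def)
    ultimately show "\<sigma> k \<in> {l \<in> {1..n} - {\<sigma> i}. (x (\<sigma> i), x l) \<in> W}" using assms(3)[OF k] by auto
  qed
  then have "card (\<sigma> ` S) \<le> near_count n x W (\<sigma> i)"
    unfolding near_count_def by (intro card_mono) auto
  moreover have "card (\<sigma> ` S) = card S"
    using assms(2) by (intro card_image inj_on_subset[OF inj]) auto
  ultimately show ?thesis by simp
qed

lemma near_count_le:
  assumes "\<And>k. k \<in> {1..n} \<Longrightarrow> k \<noteq> i \<Longrightarrow> (x (\<sigma> i), x (\<sigma> k)) \<in> W \<Longrightarrow> k \<in> S" "finite S"
  shows "near_count n x W (\<sigma> i) \<le> card S"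
proof -
  have "{l \<in> {1..n} - {\<sigma> i}. (x (\<sigma> i), x l) \<in> W} \<subseteq> \<sigma> ` S"
  proof
    fix l assume l: "l \<in> {l \<in> {1..n} - {\<sigma> i}. (x (\<sigma> i), x l) \<in> W}"
    then have "l \<in> \<sigma> ` {1..n}" using bij by (simp add: bij_betw_def)
    then obtain k where "k \<in> {1..n}" "l = \<sigma> k" by blast
    then show "l \<in> \<sigma> ` S" using l assms(1)[of k] by auto
  qed
  then have "near_count n x W (\<sigma> i) \<le> card (\<sigma> ` S)"
    unfolding near_count_def using assms(2) by (intro card_mono) auto
  also have "\<dots> \<le> card S" by (rule card_image_le[OF assms(2)])
  finally show ?thesis .
qed

text \<open>
  Since \<open>2m < n\<close>, every index \<open>i\<close> has \<open>m\<close> indices above it or \<open>m\<close> below it, and the corresponding points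
  lie between the two order statistics whose difference is the gap.  This also covers the boundary indices.
\<close>

lemma crowded_if_small_gap:
  assumes i: "i \<in> {1..n}" and g: "gap i \<le> \<delta>"
  shows "m \<le> near_count n x (ball_window \<delta>) (\<sigma> i)"
proof (cases "i + m \<le> n")
  case True
  have "card {i+1..i+m} \<le> near_count n x (ball_window \<delta>) (\<sigma> i)"
  proof (rule near_count_ge[OF i])
    fix k assume k: "k \<in> {i+1..i+m}"
    have "x (\<sigma> i) \<le> x (\<sigma> k)" "x (\<sigma> k) \<le> x (\<sigma> (i + m))" using k i True by (auto intro!: sorted)
    then show "(x (\<sigma> i), x (\<sigma> k)) \<in> ball_window \<delta>"
      using g order_stat_plus[OF i True] order_stat_minus_le[OF i] by (simp add: gap_def ball_window_def)
  qed (use True in auto)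
  then show ?thesis by simp
next
  case False
  then have mi: "m < i" using mn by linarith
  have "card {i-m..i-1} \<le> near_count n x (ball_window \<delta>) (\<sigma> i)"
  proof (rule near_count_ge[OF i])
    fix k assume k: "k \<in> {i-m..i-1}"
    have "x (\<sigma> k) \<le> x (\<sigma> i)" "x (\<sigma> (i - m)) \<le> x (\<sigma> k)" using k i mi by (auto intro!: sorted)
    then show "(x (\<sigma> i), x (\<sigma> k)) \<in> ball_window \<delta>"
      using g order_stat_minus[OF i mi] le_order_stat_plus[OF i] by (simp add: gap_def ball_window_def)
  qed (use mi i in auto)
  moreover have "card {i-m..i-1} = m" using mi m by simp
  ultimately show ?thesis by simp
qed

lemma gap_large_if_not_crowded:
  "i \<in> {1..n} \<Longrightarrow> \<not> crowded m n t x (\<sigma> i) \<Longrightarrow> 2 * (real m / real n) / t < gap i"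
  using crowded_if_small_gap[of i] unfolding crowded_def by (meson not_le)

lemma spacing_density_nonneg: "i \<in> {1..n} \<Longrightarrow> 0 \<le> spacing_density m n x i"
  unfolding spacing_density_eq using coef_bounds(1)[OF m] gap_nonneg by simp

text \<open>
  As the coefficients are at most 2, a large spacing density needs a small gap.
\<close>

lemma crowded_if_large_density:
  assumes i: "i \<in> {1..n}" and t: "0 < t" "t < spacing_density m n x i"
  shows "crowded m n t x (\<sigma> i)"
proof (rule ccontr)
  assume "\<not> crowded m n t x (\<sigma> i)"
  then have g: "2 * (real m / real n) / t < gap i" by (rule gap_large_if_not_crowded[OF i])
  have pos: "0 < 2 * (real m / real n) / t" using m mn t by simp
  have "spacing_density m n x i \<le> 2 * (real m / real n) / gap i"
    unfolding spacing_density_eq using g pos coef_bounds(2)[OF m i]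
    by (intro divide_right_mono mult_right_mono) auto
  also have "\<dots> \<le> t" using div_less_swap[OF g] g pos t by linarith
  finally show False using t by simp
qed

lemma interior_spacing_density:
  assumes "m < i" "i + m \<le> n"
  shows "spacing_density m n x i = 2 * (real m / real n) / (x (\<sigma> (i + m)) - x (\<sigma> (i - m)))"
    and "gap i = x (\<sigma> (i + m)) - x (\<sigma> (i - m))"
  using assms order_stat_plus[of i] order_stat_minus[of i]
  by (auto simp: spacing_density_eq gap_def coef_def)

text \<open>
  One of the two halves of the gap has length at most \<open>h\<close>, and it contains \<open>m\<close> points besides the centre.
\<close>

lemma many_in_closed_window:
  assumes i: "m < i" "i + m \<le> n" and g: "gap i \<le> 2 * h (x (\<sigma> i))"
  shows "\<exists>s\<in>{1, -1}. m \<le> near_count n x (closed_window s h) (\<sigma> i)"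
proof -
  have i': "i \<in> {1..n}" using i by auto
  consider "x (\<sigma> (i + m)) - x (\<sigma> i) \<le> h (x (\<sigma> i))" | "x (\<sigma> i) - x (\<sigma> (i - m)) \<le> h (x (\<sigma> i))"
    using g interior_spacing_density(2)[OF i] by linarith
  then show ?thesis
  proof cases
    case 1
    have "card {i+1..i+m} \<le> near_count n x (closed_window 1 h) (\<sigma> i)"
    proof (rule near_count_ge[OF i'])
      fix k assume k: "k \<in> {i+1..i+m}"
      have "x (\<sigma> i) \<le> x (\<sigma> k)" "x (\<sigma> k) \<le> x (\<sigma> (i + m))" using k i i' by (auto intro!: sorted)
      then show "(x (\<sigma> i), x (\<sigma> k)) \<in> closed_window 1 h"
        using 1 by (simp add: closed_window_def)
    qed (use i in auto)
    then show ?thesis by simp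
  next
    case 2
    have "card {i-m..i-1} \<le> near_count n x (closed_window (-1) h) (\<sigma> i)"
    proof (rule near_count_ge[OF i'])
      fix k assume k: "k \<in> {i-m..i-1}"
      have "x (\<sigma> k) \<le> x (\<sigma> i)" "x (\<sigma> (i - m)) \<le> x (\<sigma> k)" using k i i' by (auto intro!: sorted)
      then show "(x (\<sigma> i), x (\<sigma> k)) \<in> closed_window (-1) h"
        using 2 by (simp add: closed_window_def)
    qed (use i in auto)
    moreover have "card {i-m..i-1} = m" using i m by simp
    ultimately show ?thesis by auto
  qed
qed

text \<open>
  One of the two halves of the gap is longer than \<open>h\<close>, so the window on that side ends before the \<open>m\<close>-th
  point.
\<close>

lemma few_in_halfopen_window:
  assumes i: "m < i" "i + m \<le> n" and g: "2 * h (x (\<sigma> i)) < gap i"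
  shows "\<exists>s\<in>{1, -1}. near_count n x (halfopen_window s h) (\<sigma> i) \<le> m"
proof -
  have i': "i \<in> {1..n}" using i by auto
  consider "h (x (\<sigma> i)) < x (\<sigma> (i + m)) - x (\<sigma> i)" | "h (x (\<sigma> i)) < x (\<sigma> i) - x (\<sigma> (i - m))"
    using g interior_spacing_density(2)[OF i] by linarith
  then show ?thesis
  proof cases
    case 1
    have "near_count n x (halfopen_window 1 h) (\<sigma> i) \<le> card {i+1..i+m}"
    proof (rule near_count_le)
      fix k assume k: "k \<in> {1..n}" "(x (\<sigma> i), x (\<sigma> k)) \<in> halfopen_window 1 h"
      then have lt: "x (\<sigma> i) < x (\<sigma> k)" "x (\<sigma> k) < x (\<sigma> (i + m))"
        using 1 by (auto simp: halfopen_window_def)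
      have "\<not> k \<le> i" using sorted[of k i] lt k i' by auto
      moreover have "\<not> i + m \<le> k" using sorted[of "i + m" k] lt k i i' by auto
      ultimately show "k \<in> {i+1..i+m}" by auto
    qed auto
    then show ?thesis by simp
  next
    case 2
    have "near_count n x (halfopen_window (-1) h) (\<sigma> i) \<le> card {i-m..i-1}"
    proof (rule near_count_le)
      fix k assume k: "k \<in> {1..n}" "(x (\<sigma> i), x (\<sigma> k)) \<in> halfopen_window (-1) h"
      then have lt: "x (\<sigma> k) < x (\<sigma> i)" "x (\<sigma> (i - m)) < x (\<sigma> k)"
        using 2 by (auto simp: halfopen_window_def)
      have "\<not> i \<le> k" using sorted[of i k] lt k i' by auto
      moreover have "\<not> k \<le> i - m" using sorted[of k "i - m"] lt k i i' diff_le_self[of i m] by (auto dest: order_trans)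
      ultimately show "k \<in> {i-m..i-1}" by auto
    qed auto
    moreover have "card {i-m..i-1} = m" using i m by simp
    ultimately show ?thesis by auto
  qed
qed

text \<open>
  At such an index \<open>g = 2 (m/n) / gap\<close>, so comparing \<open>g\<close> with a level is the same as comparing the gap with
  twice the length of a window.  Not being crowded rules out a zero gap, for which \<open>g\<close> would be 0 by
  convention.
\<close>

lemma spacing_density_close:
  assumes i: "m < i" "i + m \<le> n" and T: "0 < T" and \<epsilon>: "0 < \<epsilon>" and f0: "\<And>a. 0 \<le> f a"
    and "\<not> crowded m n T x (\<sigma> i)" and typical: "\<not> atypical m n f \<epsilon> x (\<sigma> i)"
  shows "\<bar>spacing_density m n x i - f (x (\<sigma> i))\<bar> \<le> 2 * \<epsilon>"
proof -
  define v g where "v = f (x (\<sigma> i))" and "g = spacing_density m n x i"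
  have i': "i \<in> {1..n}" using i by auto
  have "2 * (real m / real n) / T < gap i" using assms(6) by (rule gap_large_if_not_crowded[OF i'])
  moreover have "0 < 2 * (real m / real n) / T" using m mn T by simp
  ultimately have gap: "0 < gap i" by linarith
  have g_eq: "g = 2 * (real m / real n) / gap i"
    unfolding g_def interior_spacing_density[OF i] ..
  have g0: "0 \<le> g" unfolding g_def by (rule spacing_density_nonneg[OF i'])
  have v0: "0 \<le> v" unfolding v_def by (rule f0)
  have "\<not> v + \<epsilon> < g"
  proof
    assume "v + \<epsilon> < g"
    then have "gap i \<le> 2 * (real m / real n / (v + \<epsilon>))"
      using less_div_swap[of "v + \<epsilon>" "2 * (real m / real n)" "gap i"] gap v0 \<epsilon> unfolding g_eq by simp
    then have "\<exists>s\<in>{1,-1}. m \<le> near_count n x (closed_window s (\<lambda>a. real m / real n / (f a + \<epsilon>))) (\<sigma> i)"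
      by (intro many_in_closed_window[OF i]) (simp add: v_def)
    then show False using typical unfolding atypical_def by blast
  qed
  moreover have "\<not> g < v - 2 * \<epsilon>"
  proof
    assume *: "g < v - 2 * \<epsilon>"
    then have v: "2 * \<epsilon> < v" "g < v - \<epsilon>" "0 < v - \<epsilon>" using g0 \<epsilon> by linarith+
    have "2 * (real m / real n / (v - \<epsilon>)) < gap i"
      using div_less_swap[of "2 * (real m / real n)" "gap i" "v - \<epsilon>"] gap v(2,3) unfolding g_eq by simp
    then have "\<exists>s\<in>{1,-1}. near_count n x (halfopen_window s (\<lambda>a. real m / real n / (f a - \<epsilon>))) (\<sigma> i) \<le> m"
      by (intro few_in_halfopen_window[OF i]) (simp add: v_def)
    then show False using typical v(1) unfolding atypical_def v_def by blast
  qed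
  ultimately show ?thesis using \<epsilon> unfolding v_def g_def by linarith
qed

text \<open>
  If \<open>g > T\<close>, the dyadic level of \<open>g\<close> selects a term of the series.  If \<open>g \<le> T\<close>, the term \<open>k = 0\<close> pays
  for crowded points, and otherwise \<open>g\<close> is within \<open>2\<epsilon>\<close> of \<open>f\<close>, or the point is atypical or a boundary
  point and the difference of the powers is bounded by \<open>T\<^sup>2\<close>.
\<close>

lemma term_error:
  assumes i: "i \<in> {1..n}" and T: "1 \<le> T" and \<epsilon>: "0 < \<epsilon>"
    and f0: "\<And>a. 0 \<le> f a" and fT: "\<And>a. f a \<le> T" and p: "p \<in> {1, 2}"
  shows "ennreal \<bar>spacing_density m n x i ^ p - f (x (\<sigma> i)) ^ p\<bar>
       \<le> local_error m n f T \<epsilon> x (\<sigma> i) + (if m < i \<and> i + m \<le> n then 0 else ennreal (T\<^sup>2))"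
proof -
  define v g where "v = f (x (\<sigma> i))" and "g = spacing_density m n x i"
  have g0: "0 \<le> g" unfolding g_def by (rule spacing_density_nonneg[OF i])
  have v: "0 \<le> v" "v \<le> T" unfolding v_def by (rule f0 fT)+
  define a where "a = (\<lambda>k. ennreal ((2 ^ (k + 1) * T)\<^sup>2) * (if crowded m n (2 ^ k * T) x (\<sigma> i) then 1 else 0))"
  have a_le: "a k \<le> (\<Sum>k. a k)" for k
    using sum_le_suminf[OF summableI, of "{k}" a] by simp
  have L: "local_error m n f T \<epsilon> x (\<sigma> i) = ennreal (4 * T * \<epsilon>)
     + ennreal (T\<^sup>2) * (if atypical m n f \<epsilon> x (\<sigma> i) then 1 else 0) + (\<Sum>k. a k)"
    by (simp add: local_error_def a_def)
  have via_a: ?thesis if "crowded m n (2 ^ k * T) x (\<sigma> i)" "\<bar>g ^ p - v ^ p\<bar> \<le> (2 ^ (k + 1) * T)\<^sup>2" for k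
  proof -
    have "ennreal \<bar>g ^ p - v ^ p\<bar> \<le> a k" using that by (simp add: a_def ennreal_leI)
    also note a_le[of k]
    also have "(\<Sum>k. a k) \<le> local_error m n f T \<epsilon> x (\<sigma> i) + (if m < i \<and> i + m \<le> n then 0 else ennreal (T\<^sup>2))"
      unfolding L by (simp add: add_increasing add_increasing2)
    finally show ?thesis by (simp add: g_def v_def)
  qed
  show ?thesis
  proof (cases "T < g")
    case True
    define k where "k = (LEAST k. g \<le> 2 ^ (k + 1) * T)"
    have "\<exists>k. g \<le> 2 ^ (k + 1) * T"
    proof -
      obtain k where k: "g < 2 ^ k" using real_arch_pow[of 2 g] by auto
      have "(2::real) ^ k * 1 \<le> 2 ^ (k + 1) * T" using T by (intro mult_mono) auto
      then show ?thesis using k by (intro exI[of _ k]) linarith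
    qed
    then have k1: "g \<le> 2 ^ (k + 1) * T" unfolding k_def by (rule LeastI_ex)
    have k2: "2 ^ k * T < g"
    proof (cases k)
      case (Suc k')
      then have "k' < (LEAST k. g \<le> 2 ^ (k + 1) * T)" by (simp add: k_def)
      then have "\<not> g \<le> 2 ^ (k' + 1) * T" by (rule not_less_Least)
      then show ?thesis using Suc by simp
    qed (use True in simp)
    have "crowded m n (2 ^ k * T) x (\<sigma> i)"
      using k2 T by (intro crowded_if_large_density[OF i]) (auto simp: g_def)
    moreover have "\<bar>g ^ p - v ^ p\<bar> \<le> (2 ^ (k + 1) * T)\<^sup>2"
    proof (rule order_trans[OF abs_power_diff_le(2)[OF p g0 k1 v(1)]])
      have "1 * T \<le> 2 ^ (k + 1) * T" using T by (intro mult_right_mono one_le_power) auto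
      then show "v \<le> 2 ^ (k + 1) * T" "1 \<le> 2 ^ (k + 1) * T" using v T by linarith+
    qed simp
    ultimately show ?thesis by (rule via_a)
  next
    case False
    note bd = abs_power_diff_le[OF p g0 _ v(1,2) T]
    show ?thesis
    proof (cases "crowded m n T x (\<sigma> i)")
      case True
      have "\<bar>g ^ p - v ^ p\<bar> \<le> T\<^sup>2" using False by (intro bd) simp
      also have "\<dots> \<le> (2 ^ (0 + 1) * T)\<^sup>2" using T by (intro power_mono) auto
      finally show ?thesis using True by (intro via_a[of 0]) auto
    next
      case not_crowded: False
      show ?thesis
      proof (cases "(m < i \<and> i + m \<le> n) \<and> \<not> atypical m n f \<epsilon> x (\<sigma> i)")
        case True
        have "\<bar>g - v\<bar> \<le> 2 * \<epsilon>" unfolding g_def v_def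
          using True not_crowded T \<epsilon> f0 by (intro spacing_density_close[where T=T]) auto
        then have "2 * T * \<bar>g - v\<bar> \<le> 2 * T * (2 * \<epsilon>)" using T by (intro mult_left_mono) auto
        then have "\<bar>g ^ p - v ^ p\<bar> \<le> 4 * T * \<epsilon>" using bd(1) False by simp
        then have "ennreal \<bar>g ^ p - v ^ p\<bar> \<le> ennreal (4 * T * \<epsilon>)" by (rule ennreal_leI)
        then show ?thesis unfolding L g_def[symmetric] v_def[symmetric] add.assoc
          by (rule add_increasing2[OF zero_le])
      next
        case other: False
        have "\<bar>g ^ p - v ^ p\<bar> \<le> T\<^sup>2" using False by (intro bd) simp
        then have "ennreal \<bar>g ^ p - v ^ p\<bar> \<le> ennreal (T\<^sup>2)" by (rule ennreal_leI)
        also have "\<dots> \<le> local_error m n f T \<epsilon> x (\<sigma> i) + (if m < i \<and> i + m \<le> n then 0 else ennreal (T\<^sup>2))"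
          using other unfolding L by (auto simp: add_increasing add_increasing2)
        finally show ?thesis by (simp add: g_def v_def)
      qed
    qed
  qed
qed

text \<open>
  Summing over ranks amounts to summing over sample points, and all but \<open>2m\<close> ranks have \<open>m\<close> ranks on either
  side.
\<close>

lemma mean_error:
  assumes T: "1 \<le> T" and \<epsilon>: "0 < \<epsilon>"
    and f0: "\<And>a. 0 \<le> f a" and fT: "\<And>a. f a \<le> T" and p: "p \<in> {1, 2}"
  shows "ennreal \<bar>1 / real n * (\<Sum>i = 1..n. spacing_density m n x i ^ p) - 1 / real n * (\<Sum>j = 1..n. f (x j) ^ p)\<bar>
     \<le> ennreal (1 / real n) * (\<Sum>j = 1..n. local_error m n f T \<epsilon> x j) + ennreal (2 * T\<^sup>2 * (real m / real n))"
proof -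
  have perm: "(\<Sum>j = 1..n. h j) = (\<Sum>i = 1..n. h (\<sigma> i))" for h :: "nat \<Rightarrow> 'c::comm_monoid_add"
    using sum.reindex_bij_betw[OF bij, of h] by simp
  have "\<bar>1 / real n * (\<Sum>i = 1..n. spacing_density m n x i ^ p) - 1 / real n * (\<Sum>j = 1..n. f (x j) ^ p)\<bar>
      = 1 / real n * \<bar>\<Sum>i = 1..n. spacing_density m n x i ^ p - f (x (\<sigma> i)) ^ p\<bar>"
    unfolding perm[of "\<lambda>j. f (x j) ^ p"] by (simp add: sum_subtractf diff_divide_distrib[symmetric])
  also have "\<dots> \<le> 1 / real n * (\<Sum>i = 1..n. \<bar>spacing_density m n x i ^ p - f (x (\<sigma> i)) ^ p\<bar>)"
    by (intro mult_left_mono sum_abs) auto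
  finally have "ennreal \<bar>1 / real n * (\<Sum>i = 1..n. spacing_density m n x i ^ p) - 1 / real n * (\<Sum>j = 1..n. f (x j) ^ p)\<bar>
      \<le> ennreal (1 / real n) * (\<Sum>i = 1..n. ennreal \<bar>spacing_density m n x i ^ p - f (x (\<sigma> i)) ^ p\<bar>)"
    by (simp add: ennreal_leI ennreal_mult'[symmetric] sum_nonneg)
  also have "\<dots> \<le> ennreal (1 / real n) * (\<Sum>i = 1..n. local_error m n f T \<epsilon> x (\<sigma> i)
                    + (if m < i \<and> i + m \<le> n then 0 else ennreal (T\<^sup>2)))"
    by (intro mult_left_mono sum_mono term_error[OF _ T \<epsilon> f0 fT p]) auto
  also have "\<dots> = ennreal (1 / real n) * (\<Sum>j = 1..n. local_error m n f T \<epsilon> x j)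
      + ennreal (1 / real n) * (\<Sum>i = 1..n. if m < i \<and> i + m \<le> n then 0 else ennreal (T\<^sup>2))"
    unfolding perm[of "local_error m n f T \<epsilon> x"] by (simp add: sum.distrib distrib_left)
  also have "(\<Sum>i = 1..n. if m < i \<and> i + m \<le> n then 0 else ennreal (T\<^sup>2))
      = of_nat (card ({1..n} - {m+1..n-m})) * ennreal (T\<^sup>2)"
  proof -
    have "(\<Sum>i = 1..n. if m < i \<and> i + m \<le> n then 0 else ennreal (T\<^sup>2))
        = (\<Sum>i \<in> {1..n} - {m+1..n-m}. ennreal (T\<^sup>2))"
      by (rule sum.mono_neutral_cong_right) auto
    then show ?thesis by simp
  qed
  also have "card ({1..n} - {m+1..n-m}) = 2 * m" using mn by (subst card_Diff_subset) auto
  also have "ennreal (1 / real n) * (of_nat (2 * m) * ennreal (T\<^sup>2)) = ennreal (2 * T\<^sup>2 * (real m / real n))"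
    unfolding ennreal_of_nat_eq_real_of_nat by (simp add: ennreal_mult'[symmetric] field_simps)
  finally show ?thesis .
qed

end

lemma mean_error_le_local_errors:
  fixes x :: "nat \<Rightarrow> real"
  assumes "0 < m" "2 * m < n" and T: "1 \<le> T" and \<epsilon>: "0 < \<epsilon>"
    and f0: "\<And>a. 0 \<le> f a" and fT: "\<And>a. f a \<le> T" and p: "p \<in> {1, 2}"
  shows "ennreal \<bar>1 / real n * (\<Sum>i = 1..n. spacing_density m n x i ^ p) - 1 / real n * (\<Sum>j = 1..n. f (x j) ^ p)\<bar>
     \<le> ennreal (1 / real n) * (\<Sum>j = 1..n. local_error m n f T \<epsilon> x j) + ennreal (2 * T\<^sup>2 * (real m / real n))"
proof -
  obtain \<sigma> where "bij_betw \<sigma> {1..n} {1..n}"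
    and "\<And>i. i \<in> {1..n} \<Longrightarrow> order_stat n x (int i) = x (\<sigma> i)"
    and "\<And>i k. 1 \<le> i \<Longrightarrow> i \<le> k \<Longrightarrow> k \<le> n \<Longrightarrow> x (\<sigma> i) \<le> x (\<sigma> k)"
    by (rule order_stat_eq_permuted[of n x]) blast
  then interpret ranked_sample m n x \<sigma> using assms(1,2) by unfold_locales auto
  show ?thesis by (rule mean_error[OF T \<epsilon> f0 fT p])
qed

section \<open>Exceptional sample points are rare\<close>

text \<open>
  This makes the bound in \<open>near_count_chernoff\<close> decay exponentially in \<open>m\<close> as soon as the mean number of
  points differs from \<open>m\<close> by a fixed factor.
\<close>

lemma chernoff_factor_less_one:
  fixes q :: real
  assumes "0 < q" "q \<noteq> 1"
  shows "q * exp (1 - q) < 1"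
proof -
  have "ln q < q - 1" using ln_le_minus_one[of q] ln_eq_minus_one[of q] assms by fastforce
  then have "q < exp (q - 1)" using assms by (metis exp_less_mono exp_ln)
  moreover have "exp (q - 1) * exp (1 - q) = 1" by (simp add: exp_add[symmetric])
  ultimately show ?thesis by (metis exp_gt_zero mult_strict_right_mono)
qed

lemma ball_window_sets [measurable]: "ball_window \<delta> \<in> sets (borel \<Otimes>\<^sub>M borel)"
proof -
  have "{z \<in> space (borel \<Otimes>\<^sub>M borel). \<bar>snd z - fst z\<bar> \<le> \<delta>} \<in> sets (borel \<Otimes>\<^sub>M (borel :: real measure))"
    by measurable
  also have "{z \<in> space (borel \<Otimes>\<^sub>M borel). \<bar>snd z - fst z\<bar> \<le> \<delta>} = ball_window \<delta>"
    by (auto simp: ball_window_def space_pair_measure)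
  finally show ?thesis .
qed

lemma closed_window_sets [measurable]:
  assumes [measurable]: "h \<in> borel_measurable borel"
  shows "closed_window s h \<in> sets (borel \<Otimes>\<^sub>M borel)"
proof -
  have "{z \<in> space (borel \<Otimes>\<^sub>M borel). 0 \<le> s * (snd z - fst z) \<and> s * (snd z - fst z) \<le> h (fst z)}
          \<in> sets (borel \<Otimes>\<^sub>M (borel :: real measure))" by measurable
  also have "{z \<in> space (borel \<Otimes>\<^sub>M borel). 0 \<le> s * (snd z - fst z) \<and> s * (snd z - fst z) \<le> h (fst z)}
      = closed_window s h"
    by (auto simp: closed_window_def space_pair_measure)
  finally show ?thesis .
qed

lemma halfopen_window_sets [measurable]:
  assumes [measurable]: "h \<in> borel_measurable borel"
  shows "halfopen_window s h \<in> sets (borel \<Otimes>\<^sub>M borel)"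
proof -
  have "{z \<in> space (borel \<Otimes>\<^sub>M borel). 0 < s * (snd z - fst z) \<and> s * (snd z - fst z) \<le> h (fst z)}
          \<in> sets (borel \<Otimes>\<^sub>M (borel :: real measure))" by measurable
  also have "{z \<in> space (borel \<Otimes>\<^sub>M borel). 0 < s * (snd z - fst z) \<and> s * (snd z - fst z) \<le> h (fst z)}
      = halfopen_window s h"
    by (auto simp: halfopen_window_def space_pair_measure)
  finally show ?thesis .
qed

lemma closed_window_section:
  assumes "s \<in> {1, -1}" "0 \<le> h x" "h x \<le> H"
  shows "{y. (x, y) \<in> closed_window s h} \<in> sets borel"
    and "{y. (x, y) \<in> closed_window s h} \<subseteq> {x-H..x+H}"
    and "emeasure lborel {y. (x, y) \<in> closed_window s h} = ennreal (h x)"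
proof -
  have "{y. (x, y) \<in> closed_window s h} = (if s = 1 then {x..x + h x} else {x - h x..x})"
    using assms by (auto simp: closed_window_def)
  then show "{y. (x, y) \<in> closed_window s h} \<in> sets borel"
    "{y. (x, y) \<in> closed_window s h} \<subseteq> {x-H..x+H}"
    "emeasure lborel {y. (x, y) \<in> closed_window s h} = ennreal (h x)"
    using assms by auto
qed

lemma halfopen_window_section:
  assumes "s \<in> {1, -1}" "0 \<le> h x" "h x \<le> H"
  shows "{y. (x, y) \<in> halfopen_window s h} \<in> sets borel"
    and "{y. (x, y) \<in> halfopen_window s h} \<subseteq> {x-H..x+H}"
    and "emeasure lborel {y. (x, y) \<in> halfopen_window s h} = ennreal (h x)"
proof -
  have "{y. (x, y) \<in> halfopen_window s h} = (if s = 1 then {x<..x + h x} else {x - h x..<x})"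
    using assms by (auto simp: halfopen_window_def)
  then show "{y. (x, y) \<in> halfopen_window s h} \<in> sets borel"
    "{y. (x, y) \<in> halfopen_window s h} \<subseteq> {x-H..x+H}"
    "emeasure lborel {y. (x, y) \<in> halfopen_window s h} = ennreal (h x)"
    using assms by auto
qed

locale density_sample = prob_space N for N :: "'b measure" +
  fixes Xs :: "nat \<Rightarrow> 'b \<Rightarrow> real" and f :: "real \<Rightarrow> real" and B :: real
  assumes f_meas [measurable]: "f \<in> borel_measurable borel"
    and f0: "\<And>x. 0 \<le> f x" and fB: "\<And>x. f x \<le> B" and B: "0 < B"
    and indep: "indep_vars (\<lambda>_. borel) Xs {1..}"
    and dist: "\<And>i. 1 \<le> i \<Longrightarrow> distr N borel (Xs i) = density lborel (\<lambda>x. ennreal (f x))"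
begin

definition \<mu> :: "real measure" where "\<mu> = density lborel (\<lambda>x. ennreal (f x))"

lemma sets_\<mu> [simp, measurable_cong]: "sets \<mu> = sets borel" and space_\<mu> [simp]: "space \<mu> = UNIV"
  by (auto simp: \<mu>_def)

lemma rv [measurable]: "1 \<le> i \<Longrightarrow> Xs i \<in> borel_measurable N"
  using indep by (auto simp: indep_vars_def)

lemma dist_\<mu>: "i \<in> {1..n} \<Longrightarrow> distr N borel (Xs i) = \<mu>"
  using dist by (simp add: \<mu>_def)

sublocale \<mu>: prob_space \<mu>
  using prob_space_distr[OF rv[of 1]] dist[of 1] by (simp add: \<mu>_def)

lemma indep_n: "indep_vars (\<lambda>_. borel) Xs {1..n}"
  by (rule indep_vars_subset[OF indep]) auto

lemma emeasure_Xs: "j \<in> {1..n} \<Longrightarrow> A \<in> sets borel \<Longrightarrow> emeasure N {\<omega> \<in> space N. Xs j \<omega> \<in> A} = emeasure \<mu> A"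
  using dist_\<mu>[of j n, symmetric] rv[of j]
  by (auto simp: emeasure_distr vimage_def Int_def conj_commute)

lemma \<mu>_le: 
  assumes [measurable]: "A \<in> sets borel" and "emeasure lborel A = ennreal h" "0 \<le> h"
  shows "measure \<mu> A \<le> B * h"
proof -
  have "emeasure \<mu> A = (\<integral>\<^sup>+y. ennreal (f y) * indicator A y \<partial>lborel)"
    by (simp add: \<mu>_def emeasure_density)
  also have "\<dots> \<le> (\<integral>\<^sup>+y. ennreal B * indicator A y \<partial>lborel)"
    by (intro nn_integral_mono mult_right_mono ennreal_leI fB) simp
  also have "\<dots> = ennreal (B * h)" using assms B by (simp add: nn_integral_cmult_indicator ennreal_mult)
  finally show ?thesis using B assms by (simp add: \<mu>.emeasure_eq_measure)
qed

text \<open>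
  Since \<open>f \<le> B\<close>, the mean number of points in the window is at most \<open>q m\<close> with \<open>q = 4 * B / t\<close>.
\<close>

lemma crowded_prob:
  assumes j: "j \<in> {1..n}" and t: "4 * B \<le> t"
  shows "emeasure N {\<omega> \<in> space N. crowded m n t (\<lambda>i. Xs i \<omega>) j} \<le> ennreal ((4 * B * exp 1 / t) ^ m)"
proof -
  define q where "q = 4 * B / t"
  have q: "0 < q" "q \<le> 1" using t B by (auto simp: q_def)
  have n: "0 < n" using j by simp
  define \<delta> where "\<delta> = 2 * (real m / real n) / t"
  have \<delta>: "0 \<le> \<delta>" using t B by (simp add: \<delta>_def)
  have "emeasure N {\<omega> \<in> space N. crowded m n t (\<lambda>i. Xs i \<omega>) j}
      \<le> emeasure N {\<omega> \<in> space N. Xs j \<omega> \<in> UNIV \<and>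
           (1 / q) ^ m \<le> (1 / q) ^ near_count n (\<lambda>i. Xs i \<omega>) (ball_window \<delta>) j}"
  proof (rule emeasure_mono)
    show "{\<omega> \<in> space N. crowded m n t (\<lambda>i. Xs i \<omega>) j} \<subseteq> {\<omega> \<in> space N. Xs j \<omega> \<in> UNIV \<and>
           (1 / q) ^ m \<le> (1 / q) ^ near_count n (\<lambda>i. Xs i \<omega>) (ball_window \<delta>) j}"
      unfolding crowded_def \<delta>_def[symmetric] using q by (auto intro!: power_increasing)
    have [measurable]: "(\<lambda>\<omega>. near_count n (\<lambda>i. Xs i \<omega>) (ball_window \<delta>) j) \<in> measurable N (count_space UNIV)"
      by (rule measurable_near_count[OF _ ball_window_sets j]) auto
    show "{\<omega> \<in> space N. Xs j \<omega> \<in> UNIV \<and>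
           (1 / q) ^ m \<le> (1 / q) ^ near_count n (\<lambda>i. Xs i \<omega>) (ball_window \<delta>) j} \<in> sets N"
      by measurable
  qed
  also have "\<dots> \<le> ennreal ((q * exp (1 - q)) ^ m)"
  proof (rule near_count_chernoff[OF prob_space_axioms indep_n j dist_\<mu> ball_window_sets _ q(1)])
    fix x :: real
    have "{y. (x, y) \<in> ball_window \<delta>} = {x-\<delta>..x+\<delta>}" by (auto simp: ball_window_def)
    then have "measure \<mu> {y. (x, y) \<in> ball_window \<delta>} \<le> B * (2 * \<delta>)"
      using \<mu>_le[of "{x-\<delta>..x+\<delta>}" "2 * \<delta>"] \<delta> by simp
    then have "(real n - 1) * measure \<mu> {y. (x, y) \<in> ball_window \<delta>} \<le> real n * (B * (2 * \<delta>))"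
      using n by (intro mult_mono) auto
    also have "\<dots> = q * real m" using n by (simp add: q_def \<delta>_def field_simps)
    finally have "(real n - 1) * measure \<mu> {y. (x, y) \<in> ball_window \<delta>} * (1 / q - 1) \<le> q * real m * (1 / q - 1)"
      using q by (intro mult_right_mono) auto
    also have "\<dots> = real m * (1 - q)" using q by (simp add: field_simps)
    finally show "(real n - 1) * measure \<mu> {y. (x, y) \<in> ball_window \<delta>} * (1 / q - 1) \<le> real m * (1 - q)" .
  qed auto
  also have "\<dots> \<le> ennreal ((4 * B * exp 1 / t) ^ m)"
  proof (intro ennreal_leI power_mono)
    have "q * exp (1 - q) \<le> q * exp 1" using q by (intro mult_left_mono) auto
    then show "q * exp (1 - q) \<le> 4 * B * exp 1 / t" by (simp add: q_def)
  qed (use q in auto)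
  finally show ?thesis .
qed

definition oscillation :: "real \<Rightarrow> real \<Rightarrow> ennreal" where
  "oscillation H x = (\<integral>\<^sup>+y. ennreal \<bar>f y - f x\<bar> * indicator {x-H..x+H} y \<partial>lborel)"

lemma oscillation_measurable [measurable]: "oscillation H \<in> borel_measurable borel"
proof -
  have "(\<lambda>x. \<integral>\<^sup>+y. ennreal \<bar>f y - f x\<bar> * (if x - H \<le> y \<and> y \<le> x + H then 1 else 0) \<partial>lborel)
         \<in> borel_measurable borel" by measurable
  also have "(\<lambda>x. \<integral>\<^sup>+y. ennreal \<bar>f y - f x\<bar> * (if x - H \<le> y \<and> y \<le> x + H then 1 else 0) \<partial>lborel) = oscillation H"
    unfolding oscillation_def by (intro ext nn_integral_cong) (auto simp: indicator_def)
  finally show ?thesis .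
qed

text \<open>
  The left-hand side is the modulus of the integral of \<open>f y - f x\<close> over \<open>y \<in> A\<close>.
\<close>

lemma measure_near_average:
  assumes [measurable]: "A \<in> sets borel" and A: "A \<subseteq> {x-H..x+H}" and h: "emeasure lborel A = ennreal h" "0 \<le> h"
    and osc: "oscillation H x \<le> ennreal c" "0 \<le> c"
  shows "\<bar>measure \<mu> A - h * f x\<bar> \<le> c"
proof -
  define D where "D = (\<integral>\<^sup>+y. ennreal \<bar>f y - f x\<bar> * indicator A y \<partial>lborel)"
  have "D \<le> oscillation H x" unfolding D_def oscillation_def
    using A by (intro nn_integral_mono) (auto simp: indicator_def)
  then have D: "D \<le> ennreal c" using osc by simp
  have int_x: "(\<integral>\<^sup>+y. ennreal (f x) * indicator A y \<partial>lborel) = ennreal (h * f x)"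
    using h f0[of x] by (simp add: nn_integral_cmult_indicator ennreal_mult mult.commute)
  have int_y: "(\<integral>\<^sup>+y. ennreal (f y) * indicator A y \<partial>lborel) = ennreal (measure \<mu> A)"
    by (simp add: \<mu>_def emeasure_density flip: \<mu>.emeasure_eq_measure[unfolded \<mu>_def])
  have tri: "ennreal (f u) \<le> ennreal (f v) + ennreal \<bar>f y - f x\<bar>"
    if "(u, v) = (x, y) \<or> (u, v) = (y, x)" for u v y
    using that f0[of x] f0[of y] by (auto simp: ennreal_plus[symmetric] simp del: ennreal_plus intro!: ennreal_leI)
  have "ennreal (measure \<mu> A) \<le> (\<integral>\<^sup>+y. ennreal (f x) * indicator A y + ennreal \<bar>f y - f x\<bar> * indicator A y \<partial>lborel)"
    unfolding int_y[symmetric] distrib_right[symmetric] by (intro nn_integral_mono mult_right_mono tri) auto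
  also have "\<dots> = ennreal (h * f x) + D" unfolding D_def int_x[symmetric] by (rule nn_integral_add) auto
  also have "\<dots> \<le> ennreal (h * f x) + ennreal c" by (intro add_left_mono D)
  finally have 1: "measure \<mu> A \<le> h * f x + c"
    using h osc f0[of x] by (simp add: ennreal_plus[symmetric] del: ennreal_plus)
  have "ennreal (h * f x) \<le> (\<integral>\<^sup>+y. ennreal (f y) * indicator A y + ennreal \<bar>f y - f x\<bar> * indicator A y \<partial>lborel)"
    unfolding int_x[symmetric] distrib_right[symmetric] by (intro nn_integral_mono mult_right_mono tri) auto
  also have "\<dots> = ennreal (measure \<mu> A) + D" unfolding D_def int_y[symmetric] by (rule nn_integral_add) auto
  also have "\<dots> \<le> ennreal (measure \<mu> A) + ennreal c" by (intro add_left_mono D)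
  finally have 2: "h * f x \<le> measure \<mu> A + c"
    using osc by (simp add: ennreal_plus[symmetric] del: ennreal_plus)
  show ?thesis using 1 2 by linarith
qed

text \<open>
  Both kinds of one-sided windows at scale \<open>r = m/n\<close> have length between \<open>r / (B + \<epsilon>)\<close> and \<open>r / \<epsilon>\<close>,
  the longer kind at centres with \<open>f > 2\<epsilon>\<close>.  At a regular centre the mass of such a window thus differs from
  \<open>f\<close> times its length by at most \<open>\<epsilon>/2\<close> times its length.
\<close>

definition regular :: "real \<Rightarrow> real \<Rightarrow> real set" where
  "regular \<epsilon> r = {x. oscillation (r / \<epsilon>) x < ennreal (\<epsilon> / (2 * (B + \<epsilon>)) * r)}"

lemma regular_sets [measurable]: "regular \<epsilon> r \<in> sets borel"
  unfolding regular_def by measurable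

text \<open>
  Markov's inequality for \<open>lebesgue_points_in_mean\<close>: the threshold in the definition of \<open>regular\<close> is
  proportional to \<open>r\<close>, as is the bound on the mean oscillation, whose factor is at our disposal.
\<close>

lemma irregular_rare:
  assumes \<epsilon>: "0 < \<epsilon>" and \<rho>: "0 < \<rho>"
  shows "\<exists>r0>0. \<forall>r. 0 < r \<and> r \<le> r0 \<longrightarrow> emeasure \<mu> (- regular \<epsilon> r) \<le> ennreal \<rho>"
proof -
  define c where "c = \<epsilon> / (2 * (B + \<epsilon>))"
  have c: "0 < c" using \<epsilon> B by (simp add: c_def)
  define \<eta> where "\<eta> = \<rho> * c * \<epsilon>"
  have \<eta>: "0 < \<eta>" using \<rho> c \<epsilon> by (simp add: \<eta>_def)
  obtain h0 where h0: "h0 > 0" and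
    osc: "\<And>h. 0 < h \<Longrightarrow> h \<le> h0 \<Longrightarrow> (\<integral>\<^sup>+x. oscillation h x \<partial>\<mu>) \<le> ennreal (\<eta> * h)"
    using lebesgue_points_in_mean[OF f_meas f0 fB B \<eta> \<mu>.prob_space_axioms[unfolded \<mu>_def]]
    unfolding oscillation_def[symmetric] \<mu>_def[symmetric] by blast
  show ?thesis
  proof (intro exI[of _ "h0 * \<epsilon>"] conjI allI impI)
    fix r assume r: "0 < r \<and> r \<le> h0 * \<epsilon>"
    have cr: "0 < c * r" using c r by simp
    have ge: "1 \<le> ennreal (1 / (c * r)) * oscillation (r / \<epsilon>) x" if "x \<in> - regular \<epsilon> r" for x
    proof -
      have "ennreal (c * r) \<le> oscillation (r / \<epsilon>) x" using that by (simp add: regular_def c_def not_less)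
      then have "ennreal (1 / (c * r)) * ennreal (c * r) \<le> ennreal (1 / (c * r)) * oscillation (r / \<epsilon>) x"
        by (rule mult_left_mono) simp
      moreover have "ennreal (1 / (c * r)) * ennreal (c * r) = 1"
        using cr by (subst ennreal_mult[symmetric]) auto
      ultimately show ?thesis by simp
    qed
    have "emeasure \<mu> (- regular \<epsilon> r) \<le> emeasure \<mu> {x \<in> UNIV. 1 \<le> ennreal (1 / (c * r)) * oscillation (r / \<epsilon>) x}"
      using ge by (intro emeasure_mono) auto
    also have "\<dots> \<le> ennreal (1 / (c * r)) * (\<integral>\<^sup>+x. oscillation (r / \<epsilon>) x * indicator UNIV x \<partial>\<mu>)"
      by (rule nn_integral_Markov_inequality) auto
    also have "\<dots> \<le> ennreal (1 / (c * r)) * ennreal (\<eta> * (r / \<epsilon>))"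
      using r \<epsilon> osc[of "r / \<epsilon>"] by (intro mult_left_mono) (auto simp: field_simps)
    also have "\<dots> = ennreal \<rho>"
      using c r \<epsilon> \<rho> by (subst ennreal_mult[symmetric]) (auto simp: \<eta>_def)
    finally show "emeasure \<mu> (- regular \<epsilon> r) \<le> ennreal \<rho>" .
  qed (use h0 \<epsilon> in auto)
qed

text \<open>
  At a regular centre the mean number of points is at most \<open>m (f + \<epsilon>/2) / (f + \<epsilon>)\<close>, and the quotient is
  increasing in \<open>f\<close>, hence at most \<open>q < 1\<close>.
\<close>

lemma closed_window_prob:
  fixes m n :: nat
  assumes j: "j \<in> {1..n}" and \<epsilon>: "0 < \<epsilon>" and s: "s \<in> {1, -1}"
  defines "r \<equiv> real m / real n" and "q \<equiv> (B + \<epsilon> / 2) / (B + \<epsilon>)"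
  shows "emeasure N {\<omega> \<in> space N. Xs j \<omega> \<in> regular \<epsilon> r \<and>
           m \<le> near_count n (\<lambda>i. Xs i \<omega>) (closed_window s (\<lambda>a. r / (f a + \<epsilon>))) j}
         \<le> ennreal ((q * exp (1 - q)) ^ m)"
proof -
  define W where "W = closed_window s (\<lambda>a. r / (f a + \<epsilon>))"
  have W: "W \<in> sets (borel \<Otimes>\<^sub>M borel)" unfolding W_def by measurable
  have q: "0 < q" "q \<le> 1" using B \<epsilon> by (auto simp: q_def)
  have n: "0 < n" using j by simp
  have r: "0 \<le> r" "real n * r = real m" using n by (auto simp: r_def)
  have "emeasure N {\<omega> \<in> space N. Xs j \<omega> \<in> regular \<epsilon> r \<and> m \<le> near_count n (\<lambda>i. Xs i \<omega>) W j}
      \<le> emeasure N {\<omega> \<in> space N. Xs j \<omega> \<in> regular \<epsilon> r \<and> (1 / q) ^ m \<le> (1 / q) ^ near_count n (\<lambda>i. Xs i \<omega>) W j}"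
  proof (rule emeasure_mono)
    show "{\<omega> \<in> space N. Xs j \<omega> \<in> regular \<epsilon> r \<and> m \<le> near_count n (\<lambda>i. Xs i \<omega>) W j}
      \<subseteq> {\<omega> \<in> space N. Xs j \<omega> \<in> regular \<epsilon> r \<and> (1 / q) ^ m \<le> (1 / q) ^ near_count n (\<lambda>i. Xs i \<omega>) W j}"
      using q by (auto intro!: power_increasing)
    have [measurable]: "(\<lambda>\<omega>. near_count n (\<lambda>i. Xs i \<omega>) W j) \<in> measurable N (count_space UNIV)"
      by (rule measurable_near_count[OF _ W j]) auto
    have [measurable]: "Xs j \<in> borel_measurable N" using j by auto
    show "{\<omega> \<in> space N. Xs j \<omega> \<in> regular \<epsilon> r \<and> (1 / q) ^ m \<le> (1 / q) ^ near_count n (\<lambda>i. Xs i \<omega>) W j} \<in> sets N"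
      by measurable
  qed
  also have "\<dots> \<le> ennreal ((q * exp (1 - q)) ^ m)"
  proof (rule near_count_chernoff[OF prob_space_axioms indep_n j dist_\<mu> W regular_sets q(1)])
    fix x assume x: "x \<in> regular \<epsilon> r"
    define h where "h = r / (f x + \<epsilon>)"
    have h: "0 \<le> h" "h \<le> r / \<epsilon>" "r / (B + \<epsilon>) \<le> h"
      using r f0[of x] fB[of x] \<epsilon> B unfolding h_def by (auto intro!: divide_left_mono)
    have A: "{y. (x, y) \<in> W} \<in> sets borel" "{y. (x, y) \<in> W} \<subseteq> {x-r/\<epsilon>..x+r/\<epsilon>}"
      "emeasure lborel {y. (x, y) \<in> W} = ennreal h"
      using closed_window_section[OF s, of "\<lambda>a. r / (f a + \<epsilon>)" x "r / \<epsilon>"] h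
      unfolding W_def h_def by auto
    have "oscillation (r / \<epsilon>) x \<le> ennreal (\<epsilon> / (2 * (B + \<epsilon>)) * r)"
      using x by (simp add: regular_def less_imp_le)
    then have "\<bar>measure \<mu> {y. (x, y) \<in> W} - h * f x\<bar> \<le> \<epsilon> / (2 * (B + \<epsilon>)) * r"
      using r \<epsilon> B by (intro measure_near_average[OF A h(1)]) auto
    moreover have "\<epsilon> / (2 * (B + \<epsilon>)) * r = \<epsilon> / 2 * (r / (B + \<epsilon>))" by (simp add: field_simps)
    moreover have "\<epsilon> / 2 * (r / (B + \<epsilon>)) \<le> \<epsilon> / 2 * h" using h \<epsilon> by (intro mult_left_mono) auto
    ultimately have "measure \<mu> {y. (x, y) \<in> W} \<le> h * f x + \<epsilon> / 2 * h" by linarith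
    also have "\<dots> = r * ((f x + \<epsilon> / 2) / (f x + \<epsilon>))" unfolding h_def by (simp add: add_divide_distrib algebra_simps)
    also have "\<dots> \<le> r * q"
    proof (rule mult_left_mono[OF _ r(1)])
      have "(B + \<epsilon> / 2) * (f x + \<epsilon>) - (f x + \<epsilon> / 2) * (B + \<epsilon>) = \<epsilon> / 2 * (B - f x)"
        by (simp add: field_simps)
      moreover have "0 \<le> \<epsilon> / 2 * (B - f x)" using fB[of x] \<epsilon> by simp
      ultimately have "(f x + \<epsilon> / 2) * (B + \<epsilon>) \<le> (B + \<epsilon> / 2) * (f x + \<epsilon>)" by linarith
      then show "(f x + \<epsilon> / 2) / (f x + \<epsilon>) \<le> q"
        using f0[of x] \<epsilon> B by (simp add: q_def divide_le_eq le_divide_eq mult.commute)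
    qed
    finally have "(real n - 1) * measure \<mu> {y. (x, y) \<in> W} \<le> real n * (r * q)"
      using n by (intro mult_mono) auto
    also have "\<dots> = q * real m" using r(2) by (simp add: mult.assoc[symmetric])
    finally have "(real n - 1) * measure \<mu> {y. (x, y) \<in> W} * (1 / q - 1) \<le> q * real m * (1 / q - 1)"
      using q by (intro mult_right_mono) auto
    also have "\<dots> = real m * (1 - q)" using q by (simp add: field_simps)
    finally show "(real n - 1) * measure \<mu> {y. (x, y) \<in> W} * (1 / q - 1) \<le> real m * (1 - q)" .
  qed auto
  finally show ?thesis by (simp add: W_def)
qed

text \<open>
  At a regular centre with \<open>f > 2\<epsilon>\<close> the mean number of points is at least
  \<open>(1 - 1/n) m (f - \<epsilon>/2) / (f - \<epsilon>)\<close>, and the quotient is at least \<open>1 + \<epsilon> / (2 * B)\<close>.  The constant \<open>q > 1\<close>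
  leaves room for the factor \<open>1 - 1/n\<close>, which stems from not counting the centre.  The condition \<open>f > 2\<epsilon>\<close> keeps
  the window shorter than \<open>(m/n) / \<epsilon>\<close>.
\<close>

lemma halfopen_window_prob:
  fixes m n :: nat
  assumes j: "j \<in> {1..n}" and \<epsilon>: "0 < \<epsilon>" and s: "s \<in> {1, -1}"
  defines "r \<equiv> real m / real n" and "q \<equiv> 1 + \<epsilon> / (4 * B)"
  assumes n_large: "q \<le> (1 - 1 / real n) * (1 + \<epsilon> / (2 * B))"
  shows "emeasure N {\<omega> \<in> space N. Xs j \<omega> \<in> regular \<epsilon> r \<inter> {a. 2 * \<epsilon> < f a} \<and>
           near_count n (\<lambda>i. Xs i \<omega>) (halfopen_window s (\<lambda>a. r / (f a - \<epsilon>))) j \<le> m}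
         \<le> ennreal ((q * exp (1 - q)) ^ m)"
proof -
  define C where "C = regular \<epsilon> r \<inter> {a. 2 * \<epsilon> < f a}"
  have C [measurable]: "C \<in> sets borel" unfolding C_def by measurable
  define W where "W = halfopen_window s (\<lambda>a. r / (f a - \<epsilon>))"
  have W: "W \<in> sets (borel \<Otimes>\<^sub>M borel)" unfolding W_def by measurable
  have q: "0 < q" "1 \<le> q" using B \<epsilon> by (auto simp: q_def add_pos_pos)
  have n: "0 < n" using j by simp
  have r: "0 \<le> r" "real n * r = real m" using n by (auto simp: r_def)
  have "emeasure N {\<omega> \<in> space N. Xs j \<omega> \<in> C \<and> near_count n (\<lambda>i. Xs i \<omega>) W j \<le> m}
      \<le> emeasure N {\<omega> \<in> space N. Xs j \<omega> \<in> C \<and> (1 / q) ^ m \<le> (1 / q) ^ near_count n (\<lambda>i. Xs i \<omega>) W j}"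
  proof (rule emeasure_mono)
    show "{\<omega> \<in> space N. Xs j \<omega> \<in> C \<and> near_count n (\<lambda>i. Xs i \<omega>) W j \<le> m}
      \<subseteq> {\<omega> \<in> space N. Xs j \<omega> \<in> C \<and> (1 / q) ^ m \<le> (1 / q) ^ near_count n (\<lambda>i. Xs i \<omega>) W j}"
      using q by (auto intro!: power_decreasing)
    have [measurable]: "(\<lambda>\<omega>. near_count n (\<lambda>i. Xs i \<omega>) W j) \<in> measurable N (count_space UNIV)"
      by (rule measurable_near_count[OF _ W j]) auto
    have [measurable]: "Xs j \<in> borel_measurable N" using j by auto
    show "{\<omega> \<in> space N. Xs j \<omega> \<in> C \<and> (1 / q) ^ m \<le> (1 / q) ^ near_count n (\<lambda>i. Xs i \<omega>) W j} \<in> sets N"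
      by measurable
  qed
  also have "\<dots> \<le> ennreal ((q * exp (1 - q)) ^ m)"
  proof (rule near_count_chernoff[OF prob_space_axioms indep_n j dist_\<mu> W C q(1)])
    fix x assume "x \<in> C"
    then have x: "x \<in> regular \<epsilon> r" "2 * \<epsilon> < f x" by (auto simp: C_def)
    define h where "h = r / (f x - \<epsilon>)"
    have h: "0 \<le> h" "h \<le> r / \<epsilon>" "r / (B + \<epsilon>) \<le> h"
      using r x(2) fB[of x] \<epsilon> B unfolding h_def by (auto intro!: divide_left_mono)
    have A: "{y. (x, y) \<in> W} \<in> sets borel" "{y. (x, y) \<in> W} \<subseteq> {x-r/\<epsilon>..x+r/\<epsilon>}"
      "emeasure lborel {y. (x, y) \<in> W} = ennreal h"
      using halfopen_window_section[OF s, of "\<lambda>a. r / (f a - \<epsilon>)" x "r / \<epsilon>"] h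
      unfolding W_def h_def by auto
    have "oscillation (r / \<epsilon>) x \<le> ennreal (\<epsilon> / (2 * (B + \<epsilon>)) * r)"
      using x by (simp add: regular_def less_imp_le)
    then have "\<bar>measure \<mu> {y. (x, y) \<in> W} - h * f x\<bar> \<le> \<epsilon> / (2 * (B + \<epsilon>)) * r"
      using r \<epsilon> B by (intro measure_near_average[OF A h(1)]) auto
    moreover have "\<epsilon> / (2 * (B + \<epsilon>)) * r = \<epsilon> / 2 * (r / (B + \<epsilon>))" by (simp add: field_simps)
    moreover have "\<epsilon> / 2 * (r / (B + \<epsilon>)) \<le> \<epsilon> / 2 * h" using h \<epsilon> by (intro mult_left_mono) auto
    ultimately have lower: "h * f x - \<epsilon> / 2 * h \<le> measure \<mu> {y. (x, y) \<in> W}" by linarith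
    have "1 + \<epsilon> / (2 * B) \<le> (f x - \<epsilon> / 2) / (f x - \<epsilon>)"
    proof -
      have "(f x - \<epsilon> / 2) / (f x - \<epsilon>) = 1 + \<epsilon> / (2 * (f x - \<epsilon>))"
        using x(2) \<epsilon> by (simp add: field_simps)
      moreover have "\<epsilon> / (2 * B) \<le> \<epsilon> / (2 * (f x - \<epsilon>))"
        using x(2) \<epsilon> fB[of x] B by (intro divide_left_mono) auto
      ultimately show ?thesis by simp
    qed
    then have "r * (1 + \<epsilon> / (2 * B)) \<le> r * ((f x - \<epsilon> / 2) / (f x - \<epsilon>))" by (rule mult_left_mono[OF _ r(1)])
    also have "\<dots> = h * f x - \<epsilon> / 2 * h" unfolding h_def by (simp add: diff_divide_distrib algebra_simps)
    also note lower
    finally have mu_ge: "r * (1 + \<epsilon> / (2 * B)) \<le> measure \<mu> {y. (x, y) \<in> W}" .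
    have "q * real m \<le> (1 - 1 / real n) * (1 + \<epsilon> / (2 * B)) * real m"
      using n_large by (rule mult_right_mono) simp
    also have "\<dots> = (real n - 1) * (r * (1 + \<epsilon> / (2 * B)))"
      using n unfolding r_def by (simp add: field_simps)
    also have "\<dots> \<le> (real n - 1) * measure \<mu> {y. (x, y) \<in> W}"
      using mu_ge n by (intro mult_left_mono) auto
    finally have "(real n - 1) * measure \<mu> {y. (x, y) \<in> W} * (1 / q - 1) \<le> q * real m * (1 / q - 1)"
      using q by (intro mult_right_mono_neg) auto
    also have "\<dots> = real m * (1 - q)" using q by (simp add: field_simps)
    finally show "(real n - 1) * measure \<mu> {y. (x, y) \<in> W} * (1 / q - 1) \<le> real m * (1 - q)" .
  qed auto
  finally show ?thesis by (simp add: W_def C_def)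
qed

lemma measurable_crowded [measurable]:
  "j \<in> {1..n} \<Longrightarrow> {\<omega> \<in> space N. crowded m n t (\<lambda>i. Xs i \<omega>) j} \<in> sets N"
proof -
  assume j: "j \<in> {1..n}"
  have [measurable]: "(\<lambda>\<omega>. near_count n (\<lambda>i. Xs i \<omega>) (ball_window (2 * (real m / real n) / t)) j) \<in> measurable N (count_space UNIV)"
    by (rule measurable_near_count[OF _ ball_window_sets j]) auto
  show ?thesis unfolding crowded_def by measurable
qed

lemma measurable_atypical [measurable]:
  "j \<in> {1..n} \<Longrightarrow> {\<omega> \<in> space N. atypical m n f \<epsilon> (\<lambda>i. Xs i \<omega>) j} \<in> sets N"
proof -
  assume j: "j \<in> {1..n}"
  then have [measurable]: "Xs j \<in> borel_measurable N" by auto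
  have [measurable]: "(\<lambda>\<omega>. near_count n (\<lambda>i. Xs i \<omega>) (closed_window s (\<lambda>a. real m / real n / (f a + \<epsilon>))) j) \<in> measurable N (count_space UNIV)" for s
    by (rule measurable_near_count[OF _ closed_window_sets j]) auto
  have [measurable]: "(\<lambda>\<omega>. near_count n (\<lambda>i. Xs i \<omega>) (halfopen_window s (\<lambda>a. real m / real n / (f a - \<epsilon>))) j) \<in> measurable N (count_space UNIV)" for s
    by (rule measurable_near_count[OF _ halfopen_window_sets j]) auto
  show ?thesis unfolding atypical_def by measurable
qed

text \<open>
  The centre is irregular, with probability at most \<open>\<rho>\<close>, or one of the four window events occurs.
\<close>

lemma atypical_rare:
  assumes \<epsilon>: "0 < \<epsilon>" and \<rho>: "0 < \<rho>"
  shows "\<exists>r0 n0 \<gamma>. 0 < r0 \<and> 0 < \<gamma> \<and> \<gamma> < 1 \<and> (\<forall>m n j. n0 \<le> n \<longrightarrow> 0 < m \<longrightarrow> real m / real n \<le> r0 \<longrightarrow> j \<in> {1..n} \<longrightarrow>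
           emeasure N {\<omega> \<in> space N. atypical m n f \<epsilon> (\<lambda>i. Xs i \<omega>) j} \<le> ennreal (\<rho> + 4 * \<gamma> ^ m))"
proof -
  define q1 q2 where "q1 = (B + \<epsilon> / 2) / (B + \<epsilon>)" and "q2 = 1 + \<epsilon> / (4 * B)"
  define \<gamma> where "\<gamma> = max (q1 * exp (1 - q1)) (q2 * exp (1 - q2))"
  have q: "0 < q1" "q1 < 1" "1 < q2" using B \<epsilon> by (auto simp: q1_def q2_def)
  have \<gamma>: "0 < \<gamma>" "\<gamma> < 1"
    using chernoff_factor_less_one[of q1] chernoff_factor_less_one[of q2] q by (auto simp: \<gamma>_def less_max_iff_disj)
  obtain r0 where r0: "0 < r0" and irr: "\<And>r. 0 < r \<Longrightarrow> r \<le> r0 \<Longrightarrow> emeasure \<mu> (- regular \<epsilon> r) \<le> ennreal \<rho>"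
    using irregular_rare[OF \<epsilon> \<rho>] by blast
  have "(\<lambda>n. (1 - 1 / real n) * (1 + \<epsilon> / (2 * B))) \<longlonglongrightarrow> (1 - 0) * (1 + \<epsilon> / (2 * B))"
    by (intro tendsto_intros lim_1_over_n)
  moreover have "q2 < (1 - 0) * (1 + \<epsilon> / (2 * B))" using \<epsilon> B by (simp add: q2_def field_simps)
  ultimately have "\<forall>\<^sub>F n in sequentially. q2 < (1 - 1 / real n) * (1 + \<epsilon> / (2 * B))"
    by (rule order_tendstoD)
  then obtain n0 where n0: "\<And>n. n0 \<le> n \<Longrightarrow> q2 \<le> (1 - 1 / real n) * (1 + \<epsilon> / (2 * B))"
    unfolding eventually_sequentially by (meson less_imp_le)
  have main: "emeasure N {\<omega> \<in> space N. atypical m n f \<epsilon> (\<lambda>i. Xs i \<omega>) j} \<le> ennreal (\<rho> + 4 * \<gamma> ^ m)"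
    if n: "n0 \<le> n" and m: "0 < m" and mr: "real m / real n \<le> r0" and j: "j \<in> {1..n}" for m n j
  proof -
    define r where "r = real m / real n"
    have r: "0 < r" "r \<le> r0" using mr m j by (auto simp: r_def)
    define U where "U = (\<lambda>s. {\<omega> \<in> space N. Xs j \<omega> \<in> regular \<epsilon> r \<and>
           m \<le> near_count n (\<lambda>i. Xs i \<omega>) (closed_window s (\<lambda>a. r / (f a + \<epsilon>))) j})"
    define L where "L = (\<lambda>s. {\<omega> \<in> space N. Xs j \<omega> \<in> regular \<epsilon> r \<inter> {a. 2 * \<epsilon> < f a} \<and>
           near_count n (\<lambda>i. Xs i \<omega>) (halfopen_window s (\<lambda>a. r / (f a - \<epsilon>))) j \<le> m})"
    define I where "I = {\<omega> \<in> space N. Xs j \<omega> \<in> - regular \<epsilon> r}"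
    have [measurable]: "Xs j \<in> borel_measurable N" using j by auto
    have [measurable]: "(\<lambda>\<omega>. near_count n (\<lambda>i. Xs i \<omega>) (closed_window s (\<lambda>a. r / (f a + \<epsilon>))) j) \<in> measurable N (count_space UNIV)" for s
      by (rule measurable_near_count[OF _ closed_window_sets j]) auto
    have [measurable]: "(\<lambda>\<omega>. near_count n (\<lambda>i. Xs i \<omega>) (halfopen_window s (\<lambda>a. r / (f a - \<epsilon>))) j) \<in> measurable N (count_space UNIV)" for s
      by (rule measurable_near_count[OF _ halfopen_window_sets j]) auto
    have meas: "U s \<in> sets N" "L s \<in> sets N" "I \<in> sets N" for s
      unfolding U_def L_def I_def by measurable
    have U: "emeasure N (U s) \<le> ennreal (\<gamma> ^ m)" if "s \<in> {1, -1}" for s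
      using closed_window_prob[OF j \<epsilon> that, of m] unfolding U_def r_def q1_def[symmetric]
      by (rule order_trans) (use q in \<open>auto simp: \<gamma>_def intro!: ennreal_leI power_mono\<close>)
    have L: "emeasure N (L s) \<le> ennreal (\<gamma> ^ m)" if "s \<in> {1, -1}" for s
      using halfopen_window_prob[OF j \<epsilon> that n0[OF n, unfolded q2_def], of m] unfolding L_def r_def q2_def[symmetric]
      by (rule order_trans) (use q in \<open>auto simp: \<gamma>_def intro!: ennreal_leI power_mono\<close>)
    have I: "emeasure N I \<le> ennreal \<rho>"
      unfolding I_def using irr[OF r] by (subst emeasure_Xs[OF j]) auto
    have "{\<omega> \<in> space N. atypical m n f \<epsilon> (\<lambda>i. Xs i \<omega>) j} \<subseteq> I \<union> ((U 1 \<union> U (-1)) \<union> (L 1 \<union> L (-1)))"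
      unfolding atypical_def r_def[symmetric] I_def U_def L_def by auto
    then have "emeasure N {\<omega> \<in> space N. atypical m n f \<epsilon> (\<lambda>i. Xs i \<omega>) j}
        \<le> emeasure N (I \<union> ((U 1 \<union> U (-1)) \<union> (L 1 \<union> L (-1))))"
      using meas by (intro emeasure_mono) auto
    also have "\<dots> \<le> emeasure N I + ((emeasure N (U 1) + emeasure N (U (-1))) + (emeasure N (L 1) + emeasure N (L (-1))))"
      using meas by (intro order_trans[OF emeasure_subadditive] add_mono order_refl) auto
    also have "\<dots> \<le> ennreal \<rho> + ((ennreal (\<gamma> ^ m) + ennreal (\<gamma> ^ m)) + (ennreal (\<gamma> ^ m) + ennreal (\<gamma> ^ m)))"
      by (intro add_mono I U L) auto
    also have "\<dots> = ennreal (\<rho> + 4 * \<gamma> ^ m)"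
      using \<rho> \<gamma> by (simp add: ennreal_plus[symmetric] del: ennreal_plus)
    finally show ?thesis .
  qed
  show ?thesis using r0 \<gamma> main by blast
qed

end

section \<open>Convergence in probability\<close>

lemma moment_difference_close:
  fixes a b A1 A2 B \<tau> e :: real
  assumes "\<bar>A1 - a\<bar> \<le> 2 * \<tau>" "\<bar>A2 - b\<bar> \<le> 2 * \<tau>" "0 \<le> a" "a \<le> B" "0 < \<tau>" "\<tau> \<le> 1" "\<tau> * (B + 2) \<le> e"
  shows "\<bar>1 / 4 * (A2 - A1\<^sup>2) - 1 / 4 * (b - a\<^sup>2)\<bar> \<le> e"
proof -
  have "\<bar>A1\<^sup>2 - a\<^sup>2\<bar> = \<bar>A1 - a\<bar> * \<bar>A1 + a\<bar>"
    by (simp add: abs_mult[symmetric] power2_eq_square algebra_simps)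
  also have "\<dots> \<le> 2 * \<tau> * (2 * B + 2)" using assms by (intro mult_mono) auto
  finally have "\<bar>A1\<^sup>2 - a\<^sup>2\<bar> \<le> 4 * (\<tau> * B) + 4 * \<tau>" by (simp add: algebra_simps)
  then show ?thesis using assms by (simp add: algebra_simps abs_if split: if_splits)
qed

context density_sample
begin

text \<open>
  The \<open>k\<close>-th term of the series has expectation at most \<open>4 ^ (k + 1) * T\<^sup>2 * 2 ^ (- (k + 1) * m)\<close> because
  \<open>4eB / (2 ^ k * T) \<le> 2 ^ (- (k + 1))\<close>.  For \<open>m \<ge> 3\<close> this is dominated by a geometric series in \<open>k\<close> with sum
  \<open>8 * T\<^sup>2 * 2 ^ (- m)\<close>.
\<close>

lemma expected_local_error:
  assumes j: "j \<in> {1..n}" and T: "0 < T" "8 * exp 1 * B \<le> T" and m: "3 \<le> m" and \<epsilon>: "0 \<le> \<epsilon>"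
    and a: "0 \<le> a" "emeasure N {\<omega> \<in> space N. atypical m n f \<epsilon> (\<lambda>i. Xs i \<omega>) j} \<le> ennreal a"
  shows "(\<integral>\<^sup>+\<omega>. local_error m n f T \<epsilon> (\<lambda>i. Xs i \<omega>) j \<partial>N) \<le> ennreal (4 * T * \<epsilon> + T\<^sup>2 * a + 8 * T\<^sup>2 * (1/2) ^ m)"
proof -
  define A where "A = {\<omega> \<in> space N. atypical m n f \<epsilon> (\<lambda>i. Xs i \<omega>) j}"
  define D where "D = (\<lambda>k. {\<omega> \<in> space N. crowded m n (2 ^ k * T) (\<lambda>i. Xs i \<omega>) j})"
  have [measurable]: "A \<in> sets N" "D k \<in> sets N" for k
    unfolding A_def D_def using measurable_atypical[OF j] measurable_crowded[OF j] by auto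
  have term_le: "ennreal ((2 ^ (k + 1) * T)\<^sup>2) * emeasure N (D k) \<le> ennreal (T\<^sup>2 * (4 * (1/2) ^ m) * (1/2) ^ k)" for k
  proof -
    have eB: "4 * B \<le> T"
    proof -
      have "(1 :: real) \<le> exp 1" by simp
      then have "(4 :: real) \<le> 8 * exp 1" by linarith
      then have "4 * B \<le> 8 * exp 1 * B" using B by (intro mult_right_mono) auto
      then show ?thesis using T by linarith
    qed
    define w where "w = (1/2 :: real) ^ (k + 1)"
    have w: "0 < w" "2 ^ (k + 1) * w = 1" by (auto simp: w_def power_divide)
    have t: "4 * B \<le> 2 ^ k * T"
    proof -
      have "1 * T \<le> 2 ^ k * T" using T by (intro mult_right_mono one_le_power) auto
      then show ?thesis using eB by linarith
    qed
    have "emeasure N (D k) \<le> ennreal ((4 * B * exp 1 / (2 ^ k * T)) ^ m)"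
      unfolding D_def by (rule crowded_prob[OF j t])
    also have "\<dots> \<le> ennreal (w ^ m)"
    proof (intro ennreal_leI power_mono)
      have "8 * exp 1 * B / (2 ^ (k + 1) * T) \<le> T / (2 ^ (k + 1) * T)"
        using T by (intro divide_right_mono) auto
      then show "4 * B * exp 1 / (2 ^ k * T) \<le> w"
        using T by (simp add: w_def power_divide mult_ac)
      show "0 \<le> 4 * B * exp 1 / (2 ^ k * T)" using T B by simp
    qed
    finally have "ennreal ((2 ^ (k + 1) * T)\<^sup>2) * emeasure N (D k) \<le> ennreal ((2 ^ (k + 1) * T)\<^sup>2) * ennreal (w ^ m)"
      by (rule mult_left_mono) simp
    also have "\<dots> = ennreal ((2 ^ (k + 1) * T)\<^sup>2 * w ^ m)"
      using w by (simp add: ennreal_mult)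
    also have "\<dots> \<le> ennreal (T\<^sup>2 * (4 * (1/2) ^ m) * (1/2) ^ k)"
    proof (rule ennreal_leI)
      obtain m' where m': "m = 3 + m'" using m le_Suc_ex by blast
      have "w ^ Suc m' \<le> (1/2) ^ (k + Suc m')"
        unfolding w_def power_mult[symmetric] by (rule power_decreasing) auto
      also have "\<dots> = 4 * (1/2) ^ m * (1/2) ^ k"
        unfolding m' by (simp add: power_add power3_eq_cube)
      finally have w_le: "w ^ Suc m' \<le> 4 * (1/2) ^ m * (1/2) ^ k" .
      have "(2 ^ (k + 1) * T)\<^sup>2 * w ^ m = T\<^sup>2 * ((2 ^ (k + 1) * w) ^ 2 * w ^ Suc m')"
        unfolding m' by (simp add: power_mult_distrib power_add power2_eq_square power3_eq_cube)
      also have "\<dots> = T\<^sup>2 * w ^ Suc m'" unfolding w(2) by simp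
      also have "\<dots> \<le> T\<^sup>2 * (4 * (1/2) ^ m * (1/2) ^ k)" by (intro mult_left_mono w_le) simp
      finally show "(2 ^ (k + 1) * T)\<^sup>2 * w ^ m \<le> T\<^sup>2 * (4 * (1/2) ^ m) * (1/2) ^ k"
        by (simp add: mult.assoc)
    qed
    finally show ?thesis .
  qed
  have "(\<integral>\<^sup>+\<omega>. local_error m n f T \<epsilon> (\<lambda>i. Xs i \<omega>) j \<partial>N)
      = (\<integral>\<^sup>+\<omega>. ennreal (4 * T * \<epsilon>) + ennreal (T\<^sup>2) * indicator A \<omega>
           + (\<Sum>k. ennreal ((2 ^ (k + 1) * T)\<^sup>2) * indicator (D k) \<omega>) \<partial>N)"
    by (intro nn_integral_cong) (auto simp: local_error_def A_def D_def indicator_def intro!: arg_cong2[where f="(+)"] suminf_cong)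
  also have "\<dots> = ennreal (4 * T * \<epsilon>) + ennreal (T\<^sup>2) * emeasure N A
           + (\<Sum>k. ennreal ((2 ^ (k + 1) * T)\<^sup>2) * emeasure N (D k))"
    by (simp add: nn_integral_add nn_integral_suminf nn_integral_cmult_indicator emeasure_space_1)
  also have "\<dots> \<le> ennreal (4 * T * \<epsilon>) + ennreal (T\<^sup>2) * ennreal a
           + (\<Sum>k. ennreal (T\<^sup>2 * (4 * (1/2) ^ m) * (1/2) ^ k))"
    using a by (intro add_mono mult_left_mono suminf_le term_le) (auto simp: A_def)
  also have "(\<Sum>k. ennreal (T\<^sup>2 * (4 * (1/2) ^ m) * (1/2) ^ k)) = ennreal (T\<^sup>2 * (4 * (1/2) ^ m) * 2)"
  proof (rule suminf_ennreal_eq)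
    have "(\<lambda>k. (1/2 :: real) ^ k) sums 2" using geometric_sums[of "1/2 :: real"] by simp
    then show "(\<lambda>k. T\<^sup>2 * (4 * (1/2) ^ m) * (1/2) ^ k) sums (T\<^sup>2 * (4 * (1/2) ^ m) * 2)"
      by (rule sums_mult)
  qed simp
  also have "ennreal (4 * T * \<epsilon>) + ennreal (T\<^sup>2) * ennreal a + ennreal (T\<^sup>2 * (4 * (1/2) ^ m) * 2)
      = ennreal (4 * T * \<epsilon> + T\<^sup>2 * a + 8 * T\<^sup>2 * (1/2) ^ m)"
    using T \<epsilon> a by (simp add: ennreal_plus[symmetric] ennreal_mult[symmetric] mult_ac del: ennreal_plus)
  finally show ?thesis .
qed

lemma measurable_local_error [measurable]:
  assumes j: "j \<in> {1..n}"
  shows "(\<lambda>\<omega>. local_error m n f T \<epsilon> (\<lambda>i. Xs i \<omega>) j) \<in> borel_measurable N"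
proof -
  have [measurable]: "Measurable.pred N (\<lambda>\<omega>. atypical m n f \<epsilon> (\<lambda>i. Xs i \<omega>) j)"
    "Measurable.pred N (\<lambda>\<omega>. crowded m n t (\<lambda>i. Xs i \<omega>) j)" for t
    using measurable_atypical[OF j] measurable_crowded[OF j] by (auto simp: pred_def)
  show ?thesis unfolding local_error_def by measurable
qed

definition total_error :: "nat \<Rightarrow> nat \<Rightarrow> real \<Rightarrow> real \<Rightarrow> 'b \<Rightarrow> ennreal" where
  "total_error m n T \<epsilon> \<omega> = ennreal (1 / real n) * (\<Sum>j = 1..n. local_error m n f T \<epsilon> (\<lambda>i. Xs i \<omega>) j)
     + ennreal (2 * T\<^sup>2 * (real m / real n))"

lemma measurable_total_error [measurable]: "total_error m n T \<epsilon> \<in> borel_measurable N"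
  unfolding total_error_def by measurable

text \<open>
  The first two of the three parts of \<open>\<eta>\<close> pay for \<open>\<epsilon>\<close> and for irregular centres; these choices fix the decay
  rate \<open>\<gamma>\<close>.  The remaining terms tend to 0 as \<open>m\<close> grows and \<open>m/n\<close> vanishes.
\<close>

lemma total_error_small:
  fixes m :: "nat \<Rightarrow> nat"
  assumes m_at_top: "filterlim m at_top sequentially"
    and m_small: "(\<lambda>n. real (m n) / real n) \<longlonglongrightarrow> 0"
    and T: "0 < T" "8 * exp 1 * B \<le> T" and \<eta>: "0 < \<eta>"
  shows "\<exists>\<epsilon>>0. \<forall>\<^sub>F n in sequentially. (\<integral>\<^sup>+\<omega>. total_error (m n) n T \<epsilon> \<omega> \<partial>N) \<le> ennreal \<eta>"
proof -
  define \<epsilon> \<rho> where "\<epsilon> = \<eta> / (12 * T)" and "\<rho> = \<eta> / (3 * T\<^sup>2)"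
  have \<epsilon>: "0 < \<epsilon>" "4 * T * \<epsilon> = \<eta> / 3" and \<rho>: "0 < \<rho>" "T\<^sup>2 * \<rho> = \<eta> / 3"
    using T \<eta> by (auto simp: \<epsilon>_def \<rho>_def)
  obtain r0 n0 \<gamma> where r0: "0 < r0" and \<gamma>: "0 < \<gamma>" "\<gamma> < 1"
    and atyp: "\<And>m n j. n0 \<le> n \<Longrightarrow> 0 < m \<Longrightarrow> real m / real n \<le> r0 \<Longrightarrow> j \<in> {1..n} \<Longrightarrow>
           emeasure N {\<omega> \<in> space N. atypical m n f \<epsilon> (\<lambda>i. Xs i \<omega>) j} \<le> ennreal (\<rho> + 4 * \<gamma> ^ m)"
    using atypical_rare[OF \<epsilon>(1) \<rho>(1)] by blast
  have pow: "(\<lambda>n. c ^ m n) \<longlonglongrightarrow> 0" if "0 < c" "c < 1" for c :: real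
    using filterlim_compose[OF LIMSEQ_realpow_zero[of c] m_at_top] that by simp
  define rest where "rest = (\<lambda>n. 4 * T\<^sup>2 * \<gamma> ^ m n + 8 * T\<^sup>2 * (1/2) ^ m n + 2 * T\<^sup>2 * (real (m n) / real n))"
  have "rest \<longlonglongrightarrow> 4 * T\<^sup>2 * 0 + 8 * T\<^sup>2 * 0 + 2 * T\<^sup>2 * 0"
    unfolding rest_def using \<gamma> by (intro tendsto_intros pow m_small) auto
  then have "\<forall>\<^sub>F n in sequentially. rest n < \<eta> / 3" using \<eta> by (intro order_tendstoD) auto
  moreover have "\<forall>\<^sub>F n in sequentially. real (m n) / real n < r0" using m_small r0 by (rule order_tendstoD)
  moreover have "\<forall>\<^sub>F n in sequentially. 3 \<le> m n" using m_at_top by (simp add: filterlim_at_top)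
  moreover have "\<forall>\<^sub>F n in sequentially. max 1 n0 \<le> n" by (rule eventually_ge_at_top)
  ultimately have "\<forall>\<^sub>F n in sequentially. (\<integral>\<^sup>+\<omega>. total_error (m n) n T \<epsilon> \<omega> \<partial>N) \<le> ennreal \<eta>"
  proof eventually_elim
    case (elim n)
    then have n: "0 < n" by simp
    define c where "c = 4 * T * \<epsilon> + T\<^sup>2 * (\<rho> + 4 * \<gamma> ^ m n) + 8 * T\<^sup>2 * (1/2) ^ m n"
    have c: "0 \<le> c" using T \<epsilon> \<rho> \<gamma> by (simp add: c_def)
    have "(\<integral>\<^sup>+\<omega>. total_error (m n) n T \<epsilon> \<omega> \<partial>N)
        = ennreal (1 / real n) * (\<Sum>j = 1..n. \<integral>\<^sup>+\<omega>. local_error (m n) n f T \<epsilon> (\<lambda>i. Xs i \<omega>) j \<partial>N)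
          + ennreal (2 * T\<^sup>2 * (real (m n) / real n))"
    proof -
      have "(\<integral>\<^sup>+\<omega>. (\<Sum>j = 1..n. local_error (m n) n f T \<epsilon> (\<lambda>i. Xs i \<omega>) j) \<partial>N)
          = (\<Sum>j = 1..n. \<integral>\<^sup>+\<omega>. local_error (m n) n f T \<epsilon> (\<lambda>i. Xs i \<omega>) j \<partial>N)"
        by (rule nn_integral_sum) (rule measurable_local_error)
      then show ?thesis unfolding total_error_def
        by (simp add: nn_integral_add nn_integral_cmult emeasure_space_1)
    qed
    also have "\<dots> \<le> ennreal (1 / real n) * (\<Sum>j = 1..n. ennreal c) + ennreal (2 * T\<^sup>2 * (real (m n) / real n))"
    proof (intro add_right_mono mult_left_mono sum_mono)
      fix j assume j: "j \<in> {1..n}"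
      show "(\<integral>\<^sup>+\<omega>. local_error (m n) n f T \<epsilon> (\<lambda>i. Xs i \<omega>) j \<partial>N) \<le> ennreal c"
        unfolding c_def using elim T \<epsilon> \<rho> \<gamma>
        by (intro expected_local_error[OF j] atyp j) auto
    qed simp
    also have "\<dots> = ennreal (c + 2 * T\<^sup>2 * (real (m n) / real n))"
      using n c by (simp add: ennreal_of_nat_eq_real_of_nat ennreal_mult[symmetric])
    also have "c + 2 * T\<^sup>2 * (real (m n) / real n) = 4 * T * \<epsilon> + T\<^sup>2 * \<rho> + rest n"
      by (simp add: c_def rest_def algebra_simps)
    also have "ennreal \<dots> \<le> ennreal \<eta>"
      using elim(1) \<epsilon>(2) \<rho>(2) by (intro ennreal_leI) linarith
    finally show ?case .
  qed
  then show ?thesis using \<epsilon>(1) by blast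
qed

text \<open>
  Hoeffding's inequality for the variables \<open>f (Xs j) ^ p\<close>, which take values in \<open>[0, B ^ p]\<close>.
\<close>

lemma law_of_large_numbers:
  assumes \<tau>: "0 < \<tau>"
  shows "(\<lambda>n. prob {\<omega> \<in> space N. \<tau> \<le> \<bar>1 / real n * (\<Sum>j = 1..n. f (Xs j \<omega>) ^ p) - (\<integral>x. f x ^ p \<partial>\<mu>)\<bar>}) \<longlonglongrightarrow> 0"
proof -
  define b where "b = B ^ p"
  have b: "0 < b" using B by (simp add: b_def)
  define d where "d = 2 * \<tau>\<^sup>2 / b\<^sup>2"
  have d: "0 < d" using \<tau> b by (simp add: d_def)
  have bound: "prob {\<omega> \<in> space N. \<tau> \<le> \<bar>1 / real n * (\<Sum>j = 1..n. f (Xs j \<omega>) ^ p) - (\<integral>x. f x ^ p \<partial>\<mu>)\<bar>}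
      \<le> 2 * exp (- d) ^ n" if n: "1 \<le> n" for n
  proof -
    have [measurable]: "Xs 1 \<in> borel_measurable N" by (rule rv) simp
    interpret H: Hoeffding_ineq_iid N "{1..n}" "\<lambda>i \<omega>. f (Xs i \<omega>) ^ p" "\<lambda>\<omega>. f (Xs 1 \<omega>) ^ p" 0 b
        "expectation (\<lambda>\<omega>. f (Xs 1 \<omega>) ^ p)"
    proof unfold_locales
      show "indep_vars (\<lambda>_. borel) (\<lambda>i \<omega>. f (Xs i \<omega>) ^ p) {1..n}"
        by (rule indep_vars_compose2[OF indep_n]) auto
      show "distr N borel (\<lambda>\<omega>. f (Xs i \<omega>) ^ p) = distr N borel (\<lambda>\<omega>. f (Xs 1 \<omega>) ^ p)" if "i \<in> {1..n}" for i
      proof -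
        have [measurable]: "Xs i \<in> borel_measurable N" using that by (intro rv) auto
        have "distr (distr N borel (Xs i)) borel (\<lambda>x. f x ^ p) = distr (distr N borel (Xs 1)) borel (\<lambda>x. f x ^ p)"
          using dist[of i] dist[of 1] that by simp
        then show ?thesis by (simp add: distr_distr o_def)
      qed
      show "AE \<omega> in N. f (Xs 1 \<omega>) ^ p \<in> {0..b}"
        using f0 fB by (intro AE_I2) (auto simp: b_def intro!: power_mono)
    qed auto
    have E: "expectation (\<lambda>\<omega>. f (Xs 1 \<omega>) ^ p) = (\<integral>x. f x ^ p \<partial>\<mu>)"
      unfolding \<mu>_def dist[of 1, OF order_refl, symmetric] by (rule integral_distr[symmetric]) auto
    have "prob {\<omega> \<in> space N. \<bar>(\<Sum>i\<in>{1..n}. f (Xs i \<omega>) ^ p) / real (card {1..n}) - expectation (\<lambda>\<omega>. f (Xs 1 \<omega>) ^ p)\<bar> \<ge> \<tau>}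
       \<le> 2 * exp (- 2 * real (card {1..n}) * \<tau>\<^sup>2 / (b - 0)\<^sup>2)"
      by (rule H.Hoeffding_ineq_abs_ge') (use \<tau> b n in auto)
    also have "- 2 * real (card {1..n}) * \<tau>\<^sup>2 / (b - 0)\<^sup>2 = real n * (- d)" by (simp add: d_def)
    finally show ?thesis unfolding E by (simp add: exp_of_nat_mult[symmetric])
  qed
  have lim: "(\<lambda>n. 2 * exp (- d) ^ n) \<longlonglongrightarrow> 0"
    using tendsto_mult_right_zero[OF LIMSEQ_realpow_zero[of "exp (- d)"], of 2] d by simp
  show ?thesis
    by (rule tendsto_sandwich[OF _ eventually_sequentiallyI[OF bound] tendsto_const lim]) auto
qed

text \<open>
  The event of a deviation is covered by three measurable events: the total error reaches \<open>\<tau>\<close>, or one of the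
  first two empirical moments of \<open>f\<close> is off by \<open>\<tau>\<close>.  Only the covering events have to be measurable,
  because a measure takes the value 0 on non-measurable sets by convention.
\<close>

lemma VJQ_tendsto_in_prob:
  fixes m :: "nat \<Rightarrow> nat"
  assumes m_range: "\<forall>\<^sub>F n in sequentially. 0 < m n \<and> 2 * m n < n"
    and m_at_top: "filterlim m at_top sequentially"
    and m_small: "(\<lambda>n. real (m n) / real n) \<longlonglongrightarrow> 0"
  shows "tendsto_in_prob N (\<lambda>n \<omega>. VJQ (m n) n (\<lambda>i. Xs i \<omega>))
           (1 / 4 * ((\<integral>x. f x ^ 2 \<partial>\<mu>) - (\<integral>x. f x ^ 1 \<partial>\<mu>)\<^sup>2))"
  unfolding tendsto_in_prob_def
proof (intro allI impI)
  fix e :: real assume e: "0 < e"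
  define a b where "a = (\<integral>x. f x ^ 1 \<partial>\<mu>)" and "b = (\<integral>x. f x ^ 2 \<partial>\<mu>)"
  define T where "T = max (max 1 B) (8 * exp 1 * B)"
  have T: "1 \<le> T" "0 < T" "8 * exp 1 * B \<le> T" "\<And>x. f x \<le> T"
    using fB by (auto simp: T_def le_max_iff_disj)
  \<comment> \<open>The moments of the spacing densities will be within \<open>2 * \<tau>\<close> of their limits: \<open>\<tau>\<close> for passing
    to the empirical moments of \<open>f\<close>, and \<open>\<tau>\<close> for the law of large numbers.\<close>
  define \<tau> where "\<tau> = min 1 (e / (B + 2))"
  have "\<tau> \<le> e / (B + 2)" by (simp add: \<tau>_def)
  then have "\<tau> * (B + 2) \<le> e" using B by (simp add: pos_le_divide_eq)
  moreover have "0 < \<tau>" "\<tau> \<le> 1" using e B by (auto simp: \<tau>_def)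
  ultimately have \<tau>: "0 < \<tau>" "\<tau> \<le> 1" "\<tau> * (B + 2) \<le> e" by auto
  have a: "0 \<le> a" "a \<le> B"
  proof -
    have int: "integrable \<mu> (\<lambda>x. f x ^ 1)"
      using f0 fB by (intro \<mu>.integrable_const_bound[where B=B]) auto
    show "0 \<le> a" unfolding a_def using f0 by (intro integral_nonneg_AE) auto
    show "a \<le> B" unfolding a_def using fB by (intro \<mu>.integral_le_const[OF int]) auto
  qed
  define mom where "mom = (\<lambda>p n \<omega>. 1 / real n * (\<Sum>j = 1..n. f (Xs j \<omega>) ^ p))"
  show "(\<lambda>n. measure N {\<omega> \<in> space N. \<bar>VJQ (m n) n (\<lambda>i. Xs i \<omega>) - 1 / 4 * ((\<integral>x. f x ^ 2 \<partial>\<mu>) - (\<integral>x. f x ^ 1 \<partial>\<mu>)\<^sup>2)\<bar> > e}) \<longlonglongrightarrow> 0"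
    unfolding a_def[symmetric] b_def[symmetric]
  proof (rule order_tendstoI)
    fix \<kappa> :: real assume \<kappa>: "0 < \<kappa>"
    obtain \<epsilon> where \<epsilon>: "0 < \<epsilon>"
      and err: "\<forall>\<^sub>F n in sequentially. (\<integral>\<^sup>+\<omega>. total_error (m n) n T \<epsilon> \<omega> \<partial>N) \<le> ennreal (\<tau> * \<kappa> / 4)"
      using total_error_small[OF m_at_top m_small T(2,3), of "\<tau> * \<kappa> / 4"] \<tau> \<kappa> by auto
    define E where "E = (\<lambda>n. {\<omega> \<in> space N. 1 \<le> ennreal (1 / \<tau>) * total_error (m n) n T \<epsilon> \<omega>})"
    define G where "G = (\<lambda>p c n. {\<omega> \<in> space N. \<tau> \<le> \<bar>mom p n \<omega> - c\<bar>})"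
    have [measurable]: "mom p n \<in> borel_measurable N" for p n
      unfolding mom_def by measurable
    have meas: "E n \<in> sets N" "G p c n \<in> sets N" for p c n unfolding E_def G_def by measurable
    have "\<forall>\<^sub>F n in sequentially. prob (G 1 a n) < \<kappa> / 4" "\<forall>\<^sub>F n in sequentially. prob (G 2 b n) < \<kappa> / 4"
      unfolding G_def mom_def a_def b_def using \<kappa>
      by (intro order_tendstoD(2)[OF law_of_large_numbers[OF \<tau>(1)]]; simp)+
    with err m_range show "\<forall>\<^sub>F n in sequentially.
        measure N {\<omega> \<in> space N. \<bar>VJQ (m n) n (\<lambda>i. Xs i \<omega>) - 1 / 4 * (b - a\<^sup>2)\<bar> > e} < \<kappa>"
    proof eventually_elim
      case (elim n)
      have "emeasure N (E n) \<le> ennreal (1 / \<tau>) * (\<integral>\<^sup>+\<omega>. total_error (m n) n T \<epsilon> \<omega> * indicator (space N) \<omega> \<partial>N)"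
        unfolding E_def by (rule nn_integral_Markov_inequality) auto
      also have "(\<integral>\<^sup>+\<omega>. total_error (m n) n T \<epsilon> \<omega> * indicator (space N) \<omega> \<partial>N) = (\<integral>\<^sup>+\<omega>. total_error (m n) n T \<epsilon> \<omega> \<partial>N)"
        by (intro nn_integral_cong) auto
      also have "ennreal (1 / \<tau>) * \<dots> \<le> ennreal (1 / \<tau>) * ennreal (\<tau> * \<kappa> / 4)"
        using elim by (intro mult_left_mono) auto
      also have "\<dots> = ennreal (\<kappa> / 4)" using \<tau> \<kappa> by (subst ennreal_mult[symmetric]) auto
      finally have PE: "prob (E n) \<le> \<kappa> / 4" using \<kappa> by (simp add: emeasure_eq_measure)
      have "{\<omega> \<in> space N. \<bar>VJQ (m n) n (\<lambda>i. Xs i \<omega>) - 1 / 4 * (b - a\<^sup>2)\<bar> > e} \<subseteq> E n \<union> (G 1 a n \<union> G 2 b n)"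
      proof (rule subsetI, rule ccontr)
        fix \<omega> assume "\<omega> \<in> {\<omega> \<in> space N. \<bar>VJQ (m n) n (\<lambda>i. Xs i \<omega>) - 1 / 4 * (b - a\<^sup>2)\<bar> > e}"
          and "\<omega> \<notin> E n \<union> (G 1 a n \<union> G 2 b n)"
        then have \<omega>: "\<omega> \<in> space N" "\<bar>VJQ (m n) n (\<lambda>i. Xs i \<omega>) - 1 / 4 * (b - a\<^sup>2)\<bar> > e"
          "ennreal (1 / \<tau>) * total_error (m n) n T \<epsilon> \<omega> < 1"
          "\<bar>mom 1 n \<omega> - a\<bar> < \<tau>" "\<bar>mom 2 n \<omega> - b\<bar> < \<tau>"
          by (auto simp: E_def G_def not_le)
        have tot: "total_error (m n) n T \<epsilon> \<omega> \<le> ennreal \<tau>"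
        proof (rule ccontr)
          assume "\<not> ?thesis"
          then have "ennreal (1 / \<tau>) * ennreal \<tau> \<le> ennreal (1 / \<tau>) * total_error (m n) n T \<epsilon> \<omega>"
            by (intro mult_left_mono) auto
          moreover have "ennreal (1 / \<tau>) * ennreal \<tau> = 1" using \<tau> by (subst ennreal_mult[symmetric]) auto
          ultimately show False using \<omega>(3) by simp
        qed
        define A where "A = (\<lambda>p. 1 / real n * (\<Sum>i = 1..n. spacing_density (m n) n (\<lambda>i. Xs i \<omega>) i ^ p))"
        have A: "\<bar>A p - mom p n \<omega>\<bar> \<le> \<tau>" if "p \<in> {1, 2}" for p
        proof -
          have "ennreal \<bar>A p - mom p n \<omega>\<bar> \<le> total_error (m n) n T \<epsilon> \<omega>"
            unfolding A_def mom_def total_error_def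
            by (rule mean_error_le_local_errors) (use elim T \<epsilon> f0 that in auto)
          also note tot
          finally show ?thesis using \<tau> by simp
        qed
        have "\<bar>1 / 4 * (A 2 - (A 1)\<^sup>2) - 1 / 4 * (b - a\<^sup>2)\<bar> \<le> e"
          using A[of 1] A[of 2] \<omega>(4,5) a \<tau> by (intro moment_difference_close[of _ _ \<tau>]) auto
        then show False using \<omega>(2) by (simp add: A_def VJQ_def)
      qed
      then have "measure N {\<omega> \<in> space N. \<bar>VJQ (m n) n (\<lambda>i. Xs i \<omega>) - 1 / 4 * (b - a\<^sup>2)\<bar> > e}
          \<le> prob (E n \<union> (G 1 a n \<union> G 2 b n))"
        by (rule finite_measure_mono) (use meas in auto)
      also have "\<dots> \<le> prob (E n) + (prob (G 1 a n) + prob (G 2 b n))"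
        using meas by (intro order_trans[OF measure_Un_le] add_left_mono measure_Un_le) auto
      also have "\<dots> < \<kappa>" using PE elim \<kappa> by simp
      finally show ?case .
    qed
  next
    fix \<kappa> :: real assume "\<kappa> < 0"
    then show "\<forall>\<^sub>F n in sequentially. \<kappa> < measure N {\<omega> \<in> space N. \<bar>VJQ (m n) n (\<lambda>i. Xs i \<omega>) - 1 / 4 * (b - a\<^sup>2)\<bar> > e}"
      by (intro always_eventually allI) (rule less_le_trans, auto)
  qed
qed

end

lemma varextropy_eq:
  assumes "prob_space M" and [measurable]: "X \<in> borel_measurable M" "f \<in> borel_measurable borel"
    and f0: "\<And>x. 0 \<le> f x" and fB: "\<And>x. f x \<le> B"
  shows "varextropy M X f = 1 / 4 * ((\<integral>x. f x ^ 2 \<partial>distr M borel X) - (\<integral>x. f x ^ 1 \<partial>distr M borel X)\<^sup>2)"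
proof -
  interpret prob_space M by fact
  have int: "integrable M (\<lambda>\<omega>. f (X \<omega>) ^ p)" for p
    using f0 fB by (intro integrable_const_bound[where B="B ^ p"]) (auto intro!: power_mono)
  have "varextropy M X f = expectation (\<lambda>\<omega>. (- (1 / 2) * f (X \<omega>))\<^sup>2) - (expectation (\<lambda>\<omega>. - (1 / 2) * f (X \<omega>)))\<^sup>2"
    unfolding varextropy_def using int[of 1] int[of 2] by (intro variance_eq) (auto simp: power_mult_distrib power_divide)
  also have "\<dots> = 1 / 4 * (expectation (\<lambda>\<omega>. f (X \<omega>) ^ 2) - (expectation (\<lambda>\<omega>. f (X \<omega>) ^ 1))\<^sup>2)"
    by (simp add: power_mult_distrib power_divide)
  finally show ?thesis by (simp add: integral_distr)
qed

text \<open>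
  Equality of distribution functions gives equality of laws, so the sample has the density \<open>f\<close>, and the limit
  found above is the varextropy of \<open>X\<close>.
\<close>

theorem theorem2p5:
  fixes M :: "'a measure" and X :: "'a \<Rightarrow> real" and F f :: "real \<Rightarrow> real"
    and N :: "'b measure" and Xs :: "nat \<Rightarrow> 'b \<Rightarrow> real" and m :: "nat \<Rightarrow> nat"
  assumes "prob_space M"
    and X_nonneg: "AE \<omega> in M. 0 \<le> X \<omega>"
    and F: "F = cdf (distr M borel X)"
    and f_nonneg: "\<And>x. 0 \<le> f x"
    and f_density: "distributed M lborel X (\<lambda>x. ennreal (f x))"
    and f_bounded: "bounded (range f)"
    and X_integrable: "integrable M X"
    and X_variance: "integrable M (\<lambda>\<omega>. (X \<omega> - prob_space.expectation M X)\<^sup>2)"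
    and "prob_space N"
    and sample_indep: "prob_space.indep_vars N (\<lambda>_. borel) Xs {1..}"
    and sample_cdf: "\<And>i. 1 \<le> i \<Longrightarrow> cdf (distr N borel (Xs i)) = F"
    and m_range: "\<And>n. 3 \<le> n \<Longrightarrow> 0 < m n \<and> real (m n) < real n / 2"
    and m_at_top: "filterlim m at_top sequentially"
    and m_small: "(\<lambda>n. real (m n) / real n) \<longlonglongrightarrow> 0"
  shows "tendsto_in_prob N (\<lambda>n \<omega>. VJQ (m n) n (\<lambda>i. Xs i \<omega>)) (varextropy M X f)"
proof -
  interpret M: prob_space M by fact
  interpret N: prob_space N by fact
  have f_meas: "f \<in> borel_measurable borel"
    using distributed_real_measurable[OF f_nonneg f_density] by simp
  have X_meas: "X \<in> borel_measurable M"
    using f_density by (auto simp: distributed_def)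
  have distr_X: "distr M borel X = density lborel (\<lambda>x. ennreal (f x))"
    unfolding distributed_distr_eq_density[OF f_density, symmetric] by (rule distr_cong) auto
  obtain B0 where B0: "\<And>x. \<bar>f x\<bar> \<le> B0" using f_bounded by (auto simp: bounded_iff)
  define B where "B = max 1 B0"
  have fB: "f x \<le> B" for x using B0[of x] by (auto simp: B_def)
  have distr_Xs: "distr N borel (Xs i) = density lborel (\<lambda>x. ennreal (f x))" if "1 \<le> i" for i
  proof -
    have "Xs i \<in> borel_measurable N" using sample_indep that by (auto simp: N.indep_vars_def)
    then have "distr N borel (Xs i) = distr M borel X"
      using sample_cdf[OF that] X_meas
      by (intro cdf_unique N.real_distribution_distr M.real_distribution_distr) (auto simp: F)
    then show ?thesis by (simp add: distr_X)
  qed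
  interpret density_sample N Xs f B
    by unfold_locales (use f_meas f_nonneg fB sample_indep distr_Xs in \<open>auto simp: B_def\<close>)
  have range: "\<forall>\<^sub>F n in sequentially. 0 < m n \<and> 2 * m n < n"
    using m_range by (intro eventually_sequentiallyI[of 3]) force
  show ?thesis
    using VJQ_tendsto_in_prob[OF range m_at_top m_small]
    unfolding varextropy_eq[OF \<open>prob_space M\<close> X_meas f_meas f_nonneg fB] distr_X \<mu>_def .
qed

end
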